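(* Let $D$ be a link diagram (with a basepoint). Then there is an isomorphism of filtered cochain complexes \[ \big(C_{\mathrm{BN}}^\ast(D;\mathbb{F}_2),(\mathcal{F}_q)\big)\cong\big(\tilde{C}_{\mathrm{BN}}^\ast(D;\mathbb{F}_2),(\tilde{\mathcal{F}}_{q+1})\big)\oplus\big(\tilde{C}_{\mathrm{BN}}^\ast(D;\mathbb{F}_2),(\tilde{\mathcal{F}}_{q-1})\big), \] that is, an isomorphism of cochain complexes carrying $\mathcal{F}_q$ onto $\tilde{\mathcal{F}}_{q+1}\oplus\tilde{\mathcal{F}}_{q-1}$ for every $q$. In particular, the unreduced spectral sequence over $\mathbb{F}_2$ (that of the filtration $(\mathcal{F}_q)$) splits into two copies of the reduced spectral sequence (that of the filtration $(\tilde{\mathcal{F}}_q)$).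
   Context: Bar-Natan complex. Let $R$ be a commutative ring with $1$ and $A=R[x]/\langle x^2-x\rangle$, with its multiplication, comultiplication $\Delta\colon A\to A\otimes A$, $\Delta(1)=1\otimes x+x\otimes 1-1\otimes 1$, $\Delta(x)=x\otimes x$, unit $R\subset A$, and counit $\varepsilon(x)=1$, $\varepsilon(1)=0$. For a link diagram $D$ with $n_+$ positive and $n_-$ negative crossings, the Bar-Natan complex $C_{\mathrm{BN}}^\ast(D;R)$ is obtained from the cube of smoothings of $D$ by Khovanov's construction with this Frobenius algebra: a vertex $v\in\{0,1\}^{n_++n_-}$ with smoothing $S$ contributes $C_S=A^{\otimes d_S}$ ($d_S$ the number of circles of $S$) in homological degree $|v|-n_-$, and edges of the cube act, up to the usual signs, by multiplication (merges) and $\Delta$ (splits). A standard generator $\xi_1\otimes\cdots\otimes\xi_{d_S}$, $\xi_i\in\{1,x\}$, has $q$-degree $\#\{i:\xi_i=1\}-\#\{i:\xi_i=x\}+|v|+n_+-2n_-$. All $q$-degrees for a given $D$ have the same parity, and $q$ below ranges over integers of that parity. The span $\mathcal{F}_q$ of the standard generators of $q$-degree $\ge q$ is a subcomplex, giving a descending filtration ($\mathcal{F}_{q+2}\subset\mathcal{F}_q$). Reduced complex. Put a basepoint on $D$. Then $x$ acts on each $C_S$ by multiplication by $x$ in the tensor factor of the circle containing the basepoint. Set $\tilde{C}_{\mathrm{BN}}^\ast(D;R)=x\,C_{\mathrm{BN}}^\ast(D;R)$ (a subcomplex), filtered by $\tilde{\mathcal{F}}_{q+1}=x\mathcal{F}_{q+2}$.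 Here $R=\mathbb{F}_2$ is the field with two elements. *)

theory Defs
  imports
    "HOL.Modules"
    "HOL-Library.Z2"
    "HOL-Library.FuncSet"
    "HOL-Library.Function_Algebras"
    "HOL-Library.Set_Algebras"
    "HOL-Library.Product_Plus"
begin

section \<open>Filtered cochain complexes\<close>

text \<open>
  The cochain groups and the filtration pieces are subsets of one ambient type, and
  \<open>filtration K q n\<close> is the degree-\<open>n\<close> part of the \<open>q\<close>-th piece of a descending filtration.
  As for the Bar-Natan complex, filtrations have step two: the index \<open>q\<close> ranges over the
  integers of one parity and the successor of the piece \<open>q\<close> is the piece \<open>q + 2\<close>. The set of
  admissible indices is passed explicitly as \<open>Q\<close> where it matters.
\<close>

record ('r, 'a) filtered_complex =
  scalar :: "'r \<Rightarrow> 'a \<Rightarrow> 'a"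
  cochains :: "int \<Rightarrow> 'a set"
  differential :: "'a \<Rightarrow> 'a"
  filtration :: "int \<Rightarrow> int \<Rightarrow> 'a set"

definition shift_filtration ::
  "int \<Rightarrow> ('r, 'a) filtered_complex \<Rightarrow> ('r, 'a) filtered_complex" where
  "shift_filtration k K = K\<lparr>filtration := (\<lambda>q. filtration K (q + k))\<rparr>"

definition direct_sum ::
  "('r, 'a) filtered_complex \<Rightarrow> ('r, 'b) filtered_complex \<Rightarrow> ('r, 'a \<times> 'b) filtered_complex" where
  "direct_sum K L =
    \<lparr>scalar = (\<lambda>c. map_prod (scalar K c) (scalar L c)),
     cochains = (\<lambda>n. cochains K n \<times> cochains L n),
     differential = map_prod (differential K) (differential L),
     filtration = (\<lambda>q n. filtration K q n \<times> filtration L q n)\<rparr>"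

definition filtered_iso ::
  "int set \<Rightarrow> ('r, 'a::ab_group_add) filtered_complex \<Rightarrow> ('r, 'b::ab_group_add) filtered_complex
    \<Rightarrow> (int \<Rightarrow> 'a \<Rightarrow> 'b) \<Rightarrow> bool" where
  "filtered_iso Q K L \<phi> \<longleftrightarrow> (\<forall>n.
     bij_betw (\<phi> n) (cochains K n) (cochains L n) \<and>
     (\<forall>a\<in>cochains K n. \<forall>b\<in>cochains K n. \<phi> n (a + b) = \<phi> n a + \<phi> n b) \<and>
     (\<forall>c. \<forall>a\<in>cochains K n. \<phi> n (scalar K c a) = scalar L c (\<phi> n a)) \<and>
     (\<forall>a\<in>cochains K n. \<phi> (n + 1) (differential K a) = differential L (\<phi> n a)) \<and>
     (\<forall>q\<in>Q. \<phi> n ` filtration K q n = filtration L q n))"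


section \<open>Spectral sequences\<close>

text \<open>
  The differential on page \<open>r\<close> maps \<open>page E r q n\<close> to \<open>page E r (q + 2 * r) (n + 1)\<close>.
  The relation \<open>survives E r q n\<close> encodes the identification of the homology of page \<open>r\<close> with
  page \<open>r + 1\<close>: it consists of the pairs \<open>(X, Y)\<close> where \<open>X\<close> is a cycle on page \<open>r\<close>
  whose homology class is identified with \<open>Y\<close>.
\<close>

record ('r, 'e) spectral_seq =
  page :: "nat \<Rightarrow> int \<Rightarrow> int \<Rightarrow> 'e set"
  page_add :: "nat \<Rightarrow> int \<Rightarrow> int \<Rightarrow> 'e \<Rightarrow> 'e \<Rightarrow> 'e"
  page_scalar :: "nat \<Rightarrow> int \<Rightarrow> int \<Rightarrow> 'r \<Rightarrow> 'e \<Rightarrow> 'e"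
  page_diff :: "nat \<Rightarrow> int \<Rightarrow> int \<Rightarrow> 'e \<Rightarrow> 'e"
  survives :: "nat \<Rightarrow> int \<Rightarrow> int \<Rightarrow> ('e \<times> 'e) set"

definition spectral_sum ::
  "('r, 'e) spectral_seq \<Rightarrow> ('r, 'f) spectral_seq \<Rightarrow> ('r, 'e \<times> 'f) spectral_seq" where
  "spectral_sum E F =
    \<lparr>page = (\<lambda>r q n. page E r q n \<times> page F r q n),
     page_add = (\<lambda>r q n X Y. (page_add E r q n (fst X) (fst Y), page_add F r q n (snd X) (snd Y))),
     page_scalar = (\<lambda>r q n c. map_prod (page_scalar E r q n c) (page_scalar F r q n c)),
     page_diff = (\<lambda>r q n. map_prod (page_diff E r q n) (page_diff F r q n)),
     survives = (\<lambda>r q n. {(X, Y). (fst X, fst Y) \<in> survives E r q n \<and>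
                                   (snd X, snd Y) \<in> survives F r q n})\<rparr>"

definition spectral_iso ::
  "int set \<Rightarrow> ('r, 'e) spectral_seq \<Rightarrow> ('r, 'f) spectral_seq
    \<Rightarrow> (nat \<Rightarrow> int \<Rightarrow> int \<Rightarrow> 'e \<Rightarrow> 'f) \<Rightarrow> bool" where
  "spectral_iso Q E F \<psi> \<longleftrightarrow> (\<forall>r. \<forall>q\<in>Q. \<forall>n.
     bij_betw (\<psi> r q n) (page E r q n) (page F r q n) \<and>
     (\<forall>X\<in>page E r q n. \<forall>Y\<in>page E r q n.
        \<psi> r q n (page_add E r q n X Y) = page_add F r q n (\<psi> r q n X) (\<psi> r q n Y)) \<and>
     (\<forall>c. \<forall>X\<in>page E r q n.
        \<psi> r q n (page_scalar E r q n c X) = page_scalar F r q n c (\<psi> r q n X)) \<and>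
     (\<forall>X\<in>page E r q n.
        \<psi> r (q + 2 * int r) (n + 1) (page_diff E r q n X) = page_diff F r q n (\<psi> r q n X)) \<and>
     map_prod (\<psi> r q n) (\<psi> (Suc r) q n) ` survives E r q n = survives F r q n)"

text \<open>
  The spectral sequence of a filtered complex:
  \<open>E\<^sub>r\<^sup>q = Z\<^sub>r\<^sup>q / B\<^sub>r\<^sup>q\<close> with \<open>Z\<^sub>r\<^sup>q = {a \<in> F\<^sub>q. d a \<in> F\<^bsub>q+2r\<^esub>}\<close> and
  \<open>B\<^sub>r\<^sup>q = Z\<^bsub>r-1\<^esub>\<^bsup>q+2\<^esup> + d Z\<^bsub>r-1\<^esub>\<^bsup>q-2(r-1)\<^esup>\<close>.
  The index \<open>r\<close> of the approximate cycles is an integer because \<open>r - 1 = -1\<close> occurs on page \<open>0\<close>.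
  Elements of the pages are cosets; \<open>scalar K c ` X\<close> and \<open>differential K ` X\<close> need not be full
  cosets of the denominator, hence the added \<open>approx_bounds\<close>.
\<close>

definition approx_cycles ::
  "('r, 'a) filtered_complex \<Rightarrow> int \<Rightarrow> int \<Rightarrow> int \<Rightarrow> 'a set" where
  "approx_cycles K r q n =
    {a \<in> filtration K q n. differential K a \<in> filtration K (q + 2 * r) (n + 1)}"

definition approx_bounds ::
  "('r, 'a::ab_group_add) filtered_complex \<Rightarrow> int \<Rightarrow> int \<Rightarrow> int \<Rightarrow> 'a set" where
  "approx_bounds K r q n =
    approx_cycles K (r - 1) (q + 2) n +
    differential K ` approx_cycles K (r - 1) (q - 2 * (r - 1)) (n - 1)"

definition spectral_sequence ::
  "('r, 'a::ab_group_add) filtered_complex \<Rightarrow> ('r, 'a set) spectral_seq" where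
  "spectral_sequence K =
    \<lparr>page = (\<lambda>r q n. (\<lambda>z. z +o approx_bounds K (int r) q n) ` approx_cycles K (int r) q n),
     page_add = (\<lambda>r q n X Y. X + Y),
     page_scalar = (\<lambda>r q n c X. scalar K c ` X + approx_bounds K (int r) q n),
     page_diff = (\<lambda>r q n X. differential K ` X + approx_bounds K (int r) (q + 2 * int r) (n + 1)),
     survives = (\<lambda>r q n. (\<lambda>z. (z +o approx_bounds K (int r) q n, z +o approx_bounds K (int r + 1) q n))
                           ` approx_cycles K (int r + 1) q n)\<rparr>"


section \<open>Link diagrams\<close>

text \<open>
  Oriented link diagrams are given by planar diagram codes. The arcs (the edges of the
  underlying 4-valent plane graph) are labelled by natural numbers, and a crossing lists the labels
  at its four ends counterclockwise, starting with the incoming end of the lower strand. Thus the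
  lower strand runs from the first to the third end; the upper strand runs from the fourth to the
  second end at a positive crossing \<open>Xp\<close>, and from the second to the fourth at a negative
  crossing \<open>Xn\<close>. Components without crossings are recorded by labels of their own in \<open>loops\<close>.
\<close>

datatype crossing = Xp nat nat nat nat | Xn nat nat nat nat

record diagram =
  crossings :: "crossing list"
  loops :: "nat set"

fun ends :: "crossing \<Rightarrow> nat list" where
  "ends (Xp i j k l) = [i, j, k, l]"
| "ends (Xn i j k l) = [i, j, k, l]"

fun incoming :: "crossing \<Rightarrow> nat list" where
  "incoming (Xp i j k l) = [i, l]"
| "incoming (Xn i j k l) = [i, j]"

fun outgoing :: "crossing \<Rightarrow> nat list" where
  "outgoing (Xp i j k l) = [k, j]"
| "outgoing (Xn i j k l) = [k, l]"

fun positive :: "crossing \<Rightarrow> bool" where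
  "positive (Xp i j k l) = True"
| "positive (Xn i j k l) = False"

definition n_crossings :: "diagram \<Rightarrow> nat" where
  "n_crossings D = length (crossings D)"

definition n_plus :: "diagram \<Rightarrow> nat" where
  "n_plus D = length (filter positive (crossings D))"

definition n_minus :: "diagram \<Rightarrow> nat" where
  "n_minus D = length (filter (\<lambda>c. \<not> positive c) (crossings D))"

definition edges :: "diagram \<Rightarrow> nat set" where
  "edges D = (\<Union>c\<in>set (crossings D). set (ends c))"

definition arcs :: "diagram \<Rightarrow> nat set" where
  "arcs D = edges D \<union> loops D"

text \<open>The class of \<open>a\<close> under the equivalence relation generated by \<open>r\<close>.\<close>

definition equiv_class :: "('a \<times> 'a) set \<Rightarrow> 'a \<Rightarrow> 'a set" where
  "equiv_class r a = (r \<union> r\<inverse>)\<^sup>* `` {a}"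

text \<open>
  Planarity is Euler's formula for the surface determined by the cyclic orders at the crossings.
  A dart \<open>(c, s)\<close> is the end number \<open>s\<close> of crossing number \<open>c\<close>. The faces are the orbits of the
  permutation of the darts that first passes to the other end of the edge and then to the
  next end counterclockwise at the crossing reached.
\<close>

definition darts :: "diagram \<Rightarrow> (nat \<times> nat) set" where
  "darts D = {..<n_crossings D} \<times> {..<4}"

definition dart_label :: "diagram \<Rightarrow> nat \<times> nat \<Rightarrow> nat" where
  "dart_label D = (\<lambda>(c, s). ends (crossings D ! c) ! s)"

definition faces :: "diagram \<Rightarrow> (nat \<times> nat) set set" where
  "faces D = equiv_class {(e, (c, (s + 1) mod 4)) | e c s.
      e \<in> darts D \<and> (c, s) \<in> darts D \<and> e \<noteq> (c, s) \<and> dart_label D e = dart_label D (c, s)}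
    ` darts D"

definition graph_components :: "diagram \<Rightarrow> nat set set" where
  "graph_components D = equiv_class {(c, c'). c < n_crossings D \<and> c' < n_crossings D \<and>
      set (ends (crossings D ! c)) \<inter> set (ends (crossings D ! c')) \<noteq> {}}
    ` {..<n_crossings D}"

definition planar :: "diagram \<Rightarrow> bool" where
  "planar D \<longleftrightarrow> int (n_crossings D) - int (card (edges D)) + int (card (faces D))
                 = 2 * int (card (graph_components D))"

definition link_diagram :: "diagram \<Rightarrow> bool" where
  "link_diagram D \<longleftrightarrow>
     distinct (concat (map incoming (crossings D))) \<and>
     distinct (concat (map outgoing (crossings D))) \<and>
     set (concat (map incoming (crossings D))) = set (concat (map outgoing (crossings D))) \<and>
     finite (loops D) \<and> loops D \<inter> edges D = {} \<and> planar D"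


section \<open>The cube of smoothings\<close>

text \<open>
  A vertex of the cube is the set \<open>v \<subseteq> {..<n_crossings D}\<close> of crossings that get the
  1-smoothing. At a crossing with ends \<open>i, j, k, l\<close> the 0-smoothing joins \<open>i\<close> to \<open>j\<close> and \<open>k\<close> to \<open>l\<close>
  (it is the oriented smoothing at a positive crossing), the 1-smoothing joins \<open>i\<close> to \<open>l\<close> and
  \<open>j\<close> to \<open>k\<close>. A circle of a smoothing is represented by the set of arcs it runs through.
\<close>

fun joins :: "crossing \<Rightarrow> bool \<Rightarrow> (nat \<times> nat) set" where
  "joins (Xp i j k l) s = (if s then {(i, l), (j, k)} else {(i, j), (k, l)})"
| "joins (Xn i j k l) s = (if s then {(i, l), (j, k)} else {(i, j), (k, l)})"

definition circle :: "diagram \<Rightarrow> nat set \<Rightarrow> nat \<Rightarrow> nat set" where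
  "circle D v = equiv_class (\<Union>c<n_crossings D. joins (crossings D ! c) (c \<in> v))"

definition circles :: "diagram \<Rightarrow> nat set \<Rightarrow> nat set set" where
  "circles D v = circle D v ` arcs D"


section \<open>The Bar-Natan complex\<close>

text \<open>
  \<open>One\<close> and \<open>X\<close> are the basis elements \<open>1\<close> and \<open>x\<close> of \<open>A = R[x]/(x\<^sup>2 - x)\<close>. Since \<open>x\<^sup>2 = x\<close>,
  the product of two of them is again one of them. \<open>comult a b c\<close> is the coefficient of
  \<open>b \<otimes> c\<close> in \<open>\<Delta>(a)\<close>.
\<close>

datatype gen = One | X

fun mult :: "gen \<Rightarrow> gen \<Rightarrow> gen" where
  "mult One b = b"
| "mult X One = X"
| "mult X X = X"

fun comult :: "gen \<Rightarrow> gen \<Rightarrow> gen \<Rightarrow> 'r::comm_ring_1" where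
  "comult One One X = 1"
| "comult One X One = 1"
| "comult One One One = - 1"
| "comult One X X = 0"
| "comult X X X = 1"
| "comult X _ _ = 0"

text \<open>
  A state \<open>(v, \<xi>)\<close> is the standard generator \<open>\<xi>\<^sub>1 \<otimes> \<dots> \<otimes> \<xi>\<^sub>d\<close> of \<open>A\<^sup>\<otimes>\<^sup>d\<close>, with tensor factors indexed
  by the circles of the smoothing \<open>v\<close>. A chain is a function from states to \<open>R\<close>
  vanishing outside \<open>states D\<close>; it stands for the linear combination with these coefficients.
\<close>

type_synonym state = "nat set \<times> (nat set \<Rightarrow> gen)"

type_synonym 'r chain = "state \<Rightarrow> 'r"

definition states :: "diagram \<Rightarrow> state set" where
  "states D = (SIGMA v : Pow {..<n_crossings D}. circles D v \<rightarrow>\<^sub>E UNIV)"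

definition hom_degree :: "diagram \<Rightarrow> state \<Rightarrow> int" where
  "hom_degree D = (\<lambda>(v, \<xi>). int (card v) - int (n_minus D))"

definition q_degree :: "diagram \<Rightarrow> state \<Rightarrow> int" where
  "q_degree D = (\<lambda>(v, \<xi>).
     int (card {C \<in> circles D v. \<xi> C = One}) - int (card {C \<in> circles D v. \<xi> C = X})
     + int (card v) + int (n_plus D) - 2 * int (n_minus D))"

definition q_indices :: "diagram \<Rightarrow> int set" where
  "q_indices D = {q. \<exists>s\<in>states D. even (q - q_degree D s)}"

definition chain_scale :: "'r::comm_ring_1 \<Rightarrow> 'r chain \<Rightarrow> 'r chain" where
  "chain_scale c f = (\<lambda>s. c * f s)"

lemma module_chain_scale: "module (chain_scale :: 'r::comm_ring_1 \<Rightarrow> _)"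
  by standard (auto simp: chain_scale_def fun_eq_iff algebra_simps)

definition generator :: "state \<Rightarrow> 'r::comm_ring_1 chain" where
  "generator s = (\<lambda>t. if t = s then 1 else 0)"

definition linear_extension ::
  "diagram \<Rightarrow> (state \<Rightarrow> 'r::comm_ring_1 chain) \<Rightarrow> 'r chain \<Rightarrow> 'r chain" where
  "linear_extension D g f = (\<Sum>s\<in>states D. chain_scale (f s) (g s))"

text \<open>
  Coefficient of the state \<open>(w, \<eta>)\<close> in the image of the state \<open>(v, \<xi>)\<close> under the edge map of the cube
  that changes crossing number \<open>c\<close> from its 0- to its 1-smoothing, so \<open>w = insert c v\<close>.
  \<open>A, B\<close> and \<open>A', B'\<close> are the circles through the crossing before and after. For a planar
  diagram exactly one of the two pairs is a pair of different circles, so the final \<open>else\<close> branch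
  does not occur.
\<close>

definition edge_coeff :: "diagram \<Rightarrow> nat \<Rightarrow> state \<Rightarrow> state \<Rightarrow> 'r::comm_ring_1" where
  "edge_coeff D c = (\<lambda>(v, \<xi>) (w, \<eta>).
     let i = ends (crossings D ! c) ! 0; k = ends (crossings D ! c) ! 2;
         A = circle D v i; B = circle D v k; A' = circle D w i; B' = circle D w k
     in if \<exists>C\<in>circles D v - {A, B}. \<eta> C \<noteq> \<xi> C then 0
        else if A \<noteq> B \<and> A' = B' then (if \<eta> A' = mult (\<xi> A) (\<xi> B) then 1 else 0)
        else if A = B \<and> A' \<noteq> B' then comult (\<xi> A) (\<eta> A') (\<eta> B')
        else 0)"

definition bn_differential :: "diagram \<Rightarrow> 'r::comm_ring_1 chain \<Rightarrow> 'r chain" where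
  "bn_differential D = linear_extension D (\<lambda>s t.
     \<Sum>c\<in>{..<n_crossings D} - fst s.
       if t \<in> states D \<and> fst t = insert c (fst s)
       then (- 1) ^ card {j \<in> fst s. j < c} * edge_coeff D c s t else 0)"

definition bn_complex :: "diagram \<Rightarrow> ('r::comm_ring_1, 'r chain) filtered_complex" where
  "bn_complex D =
    \<lparr>scalar = chain_scale,
     cochains = (\<lambda>n. module.span chain_scale
       (generator ` {s \<in> states D. hom_degree D s = n})),
     differential = bn_differential D,
     filtration = (\<lambda>q n. module.span chain_scale
       (generator ` {s \<in> states D. hom_degree D s = n \<and> q_degree D s \<ge> q}))\<rparr>"

text \<open>The basepoint is given by the arc \<open>p\<close> on which it lies.\<close>

definition x_action :: "diagram \<Rightarrow> nat \<Rightarrow> 'r::comm_ring_1 chain \<Rightarrow> 'r chain" where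
  "x_action D p = linear_extension D (\<lambda>(v, \<xi>).
     generator (v, \<xi>(circle D v p := mult X (\<xi> (circle D v p)))))"

definition reduced_bn_complex ::
  "diagram \<Rightarrow> nat \<Rightarrow> ('r::comm_ring_1, 'r chain) filtered_complex" where
  "reduced_bn_complex D p =
    \<lparr>scalar = chain_scale,
     cochains = (\<lambda>n. x_action D p ` cochains (bn_complex D) n),
     differential = bn_differential D,
     filtration = (\<lambda>q n. x_action D p ` filtration (bn_complex D) (q + 1) n)\<rparr>"

end

theory Submission
  imports Defs
begin

text \<open>
  Over the field with two elements \<open>A = R[x]/(x\<^sup>2 - x)\<close> has the orthogonal idempotents \<open>x\<close> and
  \<open>1 + x\<close>, and \<open>\<Delta>\<close> sends each of them to its own tensor square. Hence exchanging them,
  \<open>1 \<mapsto> 1\<close> and \<open>x \<mapsto> 1 + x\<close>, is an automorphism of the Frobenius algebra; applied to every circle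
  it gives an involution \<open>I\<close> of the Bar-Natan complex (\<open>idempotent_swap\<close>) that commutes with the
  differential. Two properties of \<open>I\<close> give the splitting. As \<open>1\<close> has higher \<open>q\<close>-degree than \<open>x\<close>, the
  map \<open>id + I\<close> raises the filtration by one step, \<open>(id + I) F\<^sub>q \<subseteq> F\<^bsub>q+2\<^esub>\<close>. And \<open>I x I\<close> is
  multiplication by \<open>1 + x\<close> at the basepoint, the complement of the projection \<open>x\<close>.

  The isomorphism is \<open>f \<mapsto> (x (f + I f), x f)\<close>, with inverse \<open>(g, h) \<mapsto> (h + I h) + I g\<close>. It is a
  chain map because \<open>x\<close> and \<open>I\<close> commute with the differential. It maps \<open>F\<^sub>q\<close> into
  \<open>x F\<^bsub>q+2\<^esub> \<oplus> x F\<^sub>q\<close> because \<open>id + I\<close> raises the filtration. For the inverse, \<open>x\<close> lowers the filtration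
  by at most one step, which \<open>h + I h\<close> makes up for when \<open>h \<in> x F\<^sub>q\<close>; and \<open>x F\<^bsub>q+2\<^esub> \<subseteq> F\<^sub>q\<close> is preserved by \<open>I\<close>.

  All algebraic identities between \<open>x\<close>, \<open>I\<close> and the differential are checked on the characters of
  the algebras \<open>A\<^sup>\<otimes>\<^sup>d\<close>, which separate their elements because \<open>A\<close> is a product of two copies of the
  field. A character of the smoothing \<open>v\<close> is a colouring of its circles by the values \<open>0, 1\<close> of \<open>x\<close>.
  In these terms \<open>x\<close> is multiplication by the colour of the basepoint, \<open>I\<close> inverts the colours
  (\<open>char_value_x_action\<close>, \<open>char_value_idempotent_swap\<close>), and merges and splits
  both transport a colouring of the arcs unchanged if it is constant on the circles on both sides, and
  give \<open>0\<close> otherwise (\<open>char_value_differential\<close>). The relations between the three maps are then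
  immediate.

  The spectral sequences follow formally: a filtered isomorphism maps approximate cycles and
  boundaries onto each other (\<open>spectral_iso_of_filtered_iso\<close>), and for a direct sum they are products
  (\<open>spectral_iso_direct_sum\<close>).
\<close>

section \<open>Circles before and after a change of smoothing\<close>

lemma equiv_class_equivI: "equiv UNIV ((r \<union> r\<inverse>)\<^sup>*)"
proof (rule equivI)
  have "sym (r \<union> r\<inverse>)" by (auto simp: sym_def)
  then show "sym ((r \<union> r\<inverse>)\<^sup>*)" by (rule sym_rtrancl)
qed (auto simp: refl_rtrancl trans_rtrancl)

lemma equiv_class_self: "a \<in> equiv_class r a"
  by (simp add: equiv_class_def)

lemma equiv_class_eq_iff: "equiv_class r a = equiv_class r b \<longleftrightarrow> b \<in> equiv_class r a"
  unfolding equiv_class_def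
  using eq_equiv_class_iff[OF equiv_class_equivI, of a b r] by auto

text \<open>
  A class that avoids \<open>M\<close> is built from the relation \<open>E\<close> alone, so exchanging the pairs inside \<open>M\<close>
  does not affect it. With \<open>M\<close> the ends of a crossing this shows that a change of smoothing
  leaves the circles away from the crossing unchanged.
\<close>

lemma equiv_class_change:
  assumes P: "P \<subseteq> M \<times> M" "P' \<subseteq> M \<times> M"
    and disj: "equiv_class (E \<union> P) a \<inter> M = {}"
  shows "equiv_class (E \<union> P') a = equiv_class (E \<union> P) a"
proof
  show "equiv_class (E \<union> P') a \<subseteq> equiv_class (E \<union> P) a"
  proof
    fix b assume "b \<in> equiv_class (E \<union> P') a"
    then have "(a, b) \<in> ((E \<union> P') \<union> (E \<union> P')\<inverse>)\<^sup>*" by (simp add: equiv_class_def)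
    then show "b \<in> equiv_class (E \<union> P) a"
    proof (induction rule: rtrancl_induct)
      case base then show ?case by (rule equiv_class_self)
    next
      case (step b c)
      then have "(b, c) \<in> (E \<union> P) \<union> (E \<union> P)\<inverse>" using P disj by blast
      with step.IH show ?case by (auto simp: equiv_class_def intro: rtrancl_into_rtrancl)
    qed
  qed
  show "equiv_class (E \<union> P) a \<subseteq> equiv_class (E \<union> P') a"
  proof
    fix b assume "b \<in> equiv_class (E \<union> P) a"
    then have "(a, b) \<in> ((E \<union> P) \<union> (E \<union> P)\<inverse>)\<^sup>*" by (simp add: equiv_class_def)
    then show "b \<in> equiv_class (E \<union> P') a"
    proof (induction rule: rtrancl_induct)
      case base then show ?case by (rule equiv_class_self)
    next
      case (step b c)
      have "b \<in> equiv_class (E \<union> P) a" using step.hyps(1) by (simp add: equiv_class_def)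
      then have "(b, c) \<in> (E \<union> P') \<union> (E \<union> P')\<inverse>" using step.hyps(2) P disj by blast
      with step.IH show ?case by (auto simp: equiv_class_def intro: rtrancl_into_rtrancl)
    qed
  qed
qed

abbreviation lower_in :: "diagram \<Rightarrow> nat \<Rightarrow> nat" where
  "lower_in D c \<equiv> ends (crossings D ! c) ! 0"

abbreviation lower_out :: "diagram \<Rightarrow> nat \<Rightarrow> nat" where
  "lower_out D c \<equiv> ends (crossings D ! c) ! 2"

lemma joins_ends: "joins x s \<subseteq> set (ends x) \<times> set (ends x)"
  by (cases x; cases s) auto

text \<open>
  Either smoothing joins every end to one of the two ends of the lower strand, so these two represent
  all circles through the crossing.
\<close>

lemma ends_joined:
  assumes "m \<in> set (ends x)"
  shows "m \<in> {ends x ! 0, ends x ! 2} \<or>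
    (ends x ! 0, m) \<in> joins x s \<union> (joins x s)\<inverse> \<or> (ends x ! 2, m) \<in> joins x s \<union> (joins x s)\<inverse>"
  using assms by (cases x; cases s) (auto simp: numeral_2_eq_2)

lemma lower_ends: "ends x ! 0 \<in> set (ends x)" "ends x ! 2 \<in> set (ends x)"
  by (cases x; simp add: numeral_2_eq_2)+

lemma circle_self: "a \<in> circle D v a"
  by (simp add: circle_def equiv_class_self)

lemma circle_eq_iff: "circle D v a = circle D v b \<longleftrightarrow> b \<in> circle D v a"
  by (simp add: circle_def equiv_class_eq_iff)

lemma circles_disjoint:
  assumes "C \<in> circles D v" "C' \<in> circles D v" "a \<in> C" "a \<in> C'"
  shows "C = C'"
  using assms by (auto simp: circles_def) (metis circle_eq_iff)+

lemma circles_nonempty: "C \<in> circles D v \<Longrightarrow> C \<noteq> {}"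
  by (auto simp: circles_def) (metis circle_self empty_iff)

lemma circle_meets_ends:
  assumes c: "c < n_crossings D" and m: "m \<in> set (ends (crossings D ! c))" "m \<in> circle D v a"
  shows "circle D v a \<in> {circle D v (lower_in D c), circle D v (lower_out D c)}"
proof -
  let ?r = "\<Union>c<n_crossings D. joins (crossings D ! c) (c \<in> v)"
  have join: "circle D v b = circle D v m"
    if "(b, m) \<in> joins (crossings D ! c) (c \<in> v) \<union> (joins (crossings D ! c) (c \<in> v))\<inverse>" for b
  proof -
    have "(b, m) \<in> ?r \<union> ?r\<inverse>" using that c by auto
    then show ?thesis unfolding circle_eq_iff by (auto simp: circle_def equiv_class_def)
  qed
  have "circle D v a = circle D v m" using m(2) by (simp add: circle_eq_iff)
  with ends_joined[OF m(1), of "c \<in> v"] join show ?thesis by auto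
qed

lemma circle_change:
  assumes c: "c < n_crossings D" and vw: "v - {c} = w - {c}"
    and disj: "circle D v a \<inter> set (ends (crossings D ! c)) = {}"
  shows "circle D w a = circle D v a"
proof -
  let ?E = "\<Union>j\<in>{..<n_crossings D} - {c}. joins (crossings D ! j) (j \<in> v)"
  have vE: "(\<Union>j<n_crossings D. joins (crossings D ! j) (j \<in> v))
      = ?E \<union> joins (crossings D ! c) (c \<in> v)" using c by auto
  have "(\<Union>j<n_crossings D. joins (crossings D ! j) (j \<in> w))
      = (\<Union>j\<in>{..<n_crossings D} - {c}. joins (crossings D ! j) (j \<in> w)) \<union> joins (crossings D ! c) (c \<in> w)"
    using c by auto
  moreover have "(\<Union>j\<in>{..<n_crossings D} - {c}. joins (crossings D ! j) (j \<in> w)) = ?E"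
    using vw by (intro SUP_cong refl arg_cong2[of _ _ _ _ joins]) auto
  ultimately have wE: "(\<Union>j<n_crossings D. joins (crossings D ! j) (j \<in> w))
      = ?E \<union> joins (crossings D ! c) (c \<in> w)" by simp
  show ?thesis using disj equiv_class_change[OF joins_ends joins_ends] unfolding circle_def vE wE by blast
qed

lemma circle_off_crossing:
  assumes c: "c < n_crossings D" and vw: "v - {c} = w - {c}"
    and a: "circle D v a \<notin> {circle D v (lower_in D c), circle D v (lower_out D c)}"
  shows "circle D w a = circle D v a"
    and "circle D w a \<notin> {circle D w (lower_in D c), circle D w (lower_out D c)}"
proof -
  have disj: "circle D v a \<inter> set (ends (crossings D ! c)) = {}"
    using circle_meets_ends[OF c] a by blast
  show eq: "circle D w a = circle D v a" by (rule circle_change[OF c vw disj])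
  show "circle D w a \<notin> {circle D w (lower_in D c), circle D w (lower_out D c)}"
    using disj lower_ends circle_self unfolding eq[symmetric] by (metis IntI empty_iff insertE)
qed

lemma other_circles_eq:
  assumes c: "c < n_crossings D" and vw: "v - {c} = w - {c}"
  shows "circles D v - {circle D v (lower_in D c), circle D v (lower_out D c)}
       = circles D w - {circle D w (lower_in D c), circle D w (lower_out D c)}"
proof -
  have "circles D v - {circle D v (lower_in D c), circle D v (lower_out D c)}
       \<subseteq> circles D w - {circle D w (lower_in D c), circle D w (lower_out D c)}"
    if "v - {c} = w - {c}" for v w
  proof
    fix C assume C: "C \<in> circles D v - {circle D v (lower_in D c), circle D v (lower_out D c)}"
    then obtain a where a: "a \<in> arcs D" "C = circle D v a" by (auto simp: circles_def)
    with C circle_off_crossing[OF c that, of a]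
    show "C \<in> circles D w - {circle D w (lower_in D c), circle D w (lower_out D c)}"
      by (auto simp: circles_def)
  qed
  from this[OF vw] this[OF vw[symmetric]] show ?thesis by blast
qed

text \<open>
  Both sides are the complement of the union of the circles that avoid the crossing.
\<close>

lemma crossing_circles_Un:
  assumes c: "c < n_crossings D" and vw: "v - {c} = w - {c}"
  shows "circle D v (lower_in D c) \<union> circle D v (lower_out D c)
       = circle D w (lower_in D c) \<union> circle D w (lower_out D c)"
proof -
  have "a \<in> circle D v (lower_in D c) \<union> circle D v (lower_out D c)"
    if "v - {c} = w - {c}" "a \<in> circle D w (lower_in D c) \<union> circle D w (lower_out D c)" for a v w
    using circle_off_crossing(2)[OF c that(1), of a] that(2)
    by (auto simp: circle_eq_iff[symmetric])
  from this[OF vw] this[OF vw[symmetric]] show ?thesis by blast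
qed

lemma crossing_circles_in:
  assumes c: "c < n_crossings D"
  shows "circle D v (lower_in D c) \<in> circles D v" "circle D v (lower_out D c) \<in> circles D v"
proof -
  have "crossings D ! c \<in> set (crossings D)" using c by (simp add: n_crossings_def)
  then have "lower_in D c \<in> arcs D" "lower_out D c \<in> arcs D"
    using lower_ends by (auto simp: arcs_def edges_def)
  then show "circle D v (lower_in D c) \<in> circles D v" "circle D v (lower_out D c) \<in> circles D v"
    by (auto simp: circles_def)
qed

section \<open>Chains over the field with two elements\<close>

lemma UNIV_gen: "(UNIV :: gen set) = {One, X}"
  using gen.exhaust by auto

instance gen :: finite
  by standard (simp add: UNIV_gen)

lemma finite_circles: "finite (arcs D) \<Longrightarrow> finite (circles D v)"
  by (simp add: circles_def)

lemma finite_states: "finite (arcs D) \<Longrightarrow> finite (states D)"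
  unfolding states_def by (intro finite_SigmaI finite_PiE finite_circles) auto

lemma link_diagram_finite_arcs: "link_diagram D \<Longrightarrow> finite (arcs D)"
  by (auto simp: link_diagram_def arcs_def edges_def)

text \<open>
  Membership in the cochain groups and in the filtration pieces becomes a condition on supports.
\<close>

lemma module_span_generator:
  assumes "finite T"
  shows "module.span chain_scale (generator ` T :: 'r::comm_ring_1 chain set) = {f. \<forall>s. f s \<noteq> 0 \<longrightarrow> s \<in> T}"
proof -
  interpret module "chain_scale :: 'r \<Rightarrow> 'r chain \<Rightarrow> 'r chain" by (rule module_chain_scale)
  show ?thesis
  proof
    show "span (generator ` T) \<subseteq> {f. \<forall>s. f s \<noteq> 0 \<longrightarrow> s \<in> T}"
    proof (rule span_minimal)
      show "generator ` T \<subseteq> {f. \<forall>s. f s \<noteq> 0 \<longrightarrow> s \<in> T}" by (auto simp: generator_def split: if_splits)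
      show "subspace {f. \<forall>s. f s \<noteq> (0::'r) \<longrightarrow> s \<in> T}"
        by (rule subspaceI) (simp_all add: chain_scale_def, metis add.right_neutral, metis mult_zero_right)
    qed
    show "{f. \<forall>s. f s \<noteq> 0 \<longrightarrow> s \<in> T} \<subseteq> span (generator ` T)"
    proof clarify
      fix f :: "'r chain" assume f: "\<forall>s. f s \<noteq> 0 \<longrightarrow> s \<in> T"
      have ptw: "(\<Sum>s\<in>U. chain_scale (f s) (generator s)) t = (if t \<in> U then f t else 0)"
        if "finite U" for U t
        using that by (induction U) (auto simp: chain_scale_def generator_def)
      have "f = (\<Sum>s\<in>T. chain_scale (f s) (generator s))"
        by (rule ext) (use f ptw[OF assms] in auto)
      also have "\<dots> \<in> span (generator ` T)"
        by (intro span_sum span_scale span_base) auto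
      finally show "f \<in> span (generator ` T)" .
    qed
  qed
qed

lemma cochains_bn:
  assumes "finite (arcs D)"
  shows "cochains (bn_complex D :: ('r::comm_ring_1, 'r chain) filtered_complex) n
    = {f. \<forall>s. f s \<noteq> 0 \<longrightarrow> s \<in> states D \<and> hom_degree D s = n}"
  using finite_states[OF assms] by (simp add: bn_complex_def module_span_generator)

lemma filtration_bn:
  assumes "finite (arcs D)"
  shows "filtration (bn_complex D :: ('r::comm_ring_1, 'r chain) filtered_complex) q n
    = {f. \<forall>s. f s \<noteq> 0 \<longrightarrow> s \<in> states D \<and> hom_degree D s = n \<and> q \<le> q_degree D s}"
  using finite_states[OF assms] by (simp add: bn_complex_def module_span_generator)

lemma linear_extension_apply: "linear_extension D g f t = (\<Sum>s\<in>states D. f s * g s t)"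
proof -
  have "(\<Sum>s\<in>U. chain_scale (f s) (g s)) t = (\<Sum>s\<in>U. f s * g s t)" for U
    by (induction U rule: infinite_finite_induct) (auto simp: chain_scale_def)
  then show ?thesis by (simp add: linear_extension_def)
qed

lemma linear_extension_add:
  "linear_extension D g (a + b) = linear_extension D g a + linear_extension D g b"
  by (rule ext) (simp add: linear_extension_apply distrib_right sum.distrib)

lemma linear_extension_zero: "linear_extension D g 0 = 0"
  by (rule ext) (simp add: linear_extension_apply)

text \<open>
  These rules turn sums and products in the field \<open>bit\<close> into bitwise operations, out of reach of
  the rules for sums over finite sets.
\<close>
declare add_bit_eq_xor [simp del] mult_bit_eq_and [simp del]
  bit_not_zero_iff [simp del] bit_not_one_iff [simp del]

text \<open>Conditions on all states are used for a state as a whole, not for its two components.\<close>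
declare split_paired_All [simp del]

lemma bit_add_self: "a + a = (0::bit)"
  by (cases a) (simp_all add: add_bit_eq_xor)

lemma chain_add_self: "f + f = (0 :: bit chain)"
  by (rule ext) (simp add: bit_add_self)

section \<open>Evaluation at the characters of the smoothings\<close>

definition supported :: "diagram \<Rightarrow> bit chain \<Rightarrow> bool" where
  "supported D f \<longleftrightarrow> (\<forall>s. f s \<noteq> 0 \<longrightarrow> s \<in> states D)"

text \<open>
  A state of a given smoothing is determined by the set of circles labelled \<open>x\<close>. In these terms the
  characters, the exchange of the idempotents and the \<open>q\<close>-degree depend only on inclusions and
  cardinalities of sets.
\<close>

definition x_circles :: "diagram \<Rightarrow> state \<Rightarrow> nat set set" where
  "x_circles D s = {C \<in> circles D (fst s). snd s C = X}"

text \<open>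
  The value of the component of \<open>f\<close> at the smoothing \<open>v\<close> under the character of \<open>A\<^sup>\<otimes>\<^sup>d\<close> that maps the
  factor \<open>x\<close> of a circle to \<open>1\<close> if the circle lies in \<open>S\<close> and to \<open>0\<close> otherwise: it maps a
  standard generator to \<open>1\<close> exactly if all circles labelled \<open>x\<close> lie in \<open>S\<close>. The set \<open>S\<close> consists of arcs
  rather than of circles so that one \<open>S\<close> can be used at both ends of an edge of the cube.
\<close>

definition char_value :: "diagram \<Rightarrow> bit chain \<Rightarrow> nat set \<Rightarrow> nat set \<Rightarrow> bit" where
  "char_value D f v S = (\<Sum>s\<in>{s \<in> states D. fst s = v}. if x_circles D s \<subseteq> Pow S then f s else 0)"

definition saturated :: "diagram \<Rightarrow> nat set \<Rightarrow> nat set \<Rightarrow> bool" where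
  "saturated D v S \<longleftrightarrow> (\<forall>C\<in>circles D v. C \<subseteq> S \<or> C \<subseteq> - S)"

lemma saturated_compl: "saturated D v (- S) \<longleftrightarrow> saturated D v S"
  by (auto simp: saturated_def)

lemma x_circles_subset: "x_circles D s \<subseteq> circles D (fst s)"
  by (auto simp: x_circles_def)

lemma state_eqI:
  assumes "s \<in> states D" "t \<in> states D" "fst s = fst t" "x_circles D s = x_circles D t"
  shows "s = t"
proof (rule prod_eqI)
  show "snd s = snd t"
  proof
    fix C
    have "snd s C = X \<longleftrightarrow> snd t C = X" if "C \<in> circles D (fst t)"
      using assms(3,4) that unfolding x_circles_def by auto
    then show "snd s C = snd t C"
      using assms(1-3) by (cases "snd s C"; cases "snd t C"; cases "C \<in> circles D (fst t)")
        (auto simp: states_def PiE_def extensional_def)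
  qed
qed fact

lemma bij_betw_x_circles:
  assumes "v \<subseteq> {..<n_crossings D}"
  shows "bij_betw (x_circles D) {s \<in> states D. fst s = v} (Pow (circles D v))"
proof (rule bij_betwI')
  fix U assume U: "U \<in> Pow (circles D v)"
  define s where "s = (v, \<lambda>C\<in>circles D v. if C \<in> U then X else One)"
  have "s \<in> {s \<in> states D. fst s = v}" "x_circles D s = U"
    using assms U by (auto simp: s_def states_def x_circles_def split: if_splits)
  then show "\<exists>s\<in>{s \<in> states D. fst s = v}. U = x_circles D s" by (intro bexI[of _ s]) simp_all
qed (use x_circles_subset state_eqI in auto)

lemma q_degree_eq:
  assumes "finite (arcs D)" "s \<in> states D"
  shows "q_degree D s = int (card (circles D (fst s))) - 2 * int (card (x_circles D s))
    + int (card (fst s)) + int (n_plus D) - 2 * int (n_minus D)"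
proof -
  obtain v \<xi> where s: "s = (v, \<xi>)" by (cases s)
  have "circles D v = {C \<in> circles D v. \<xi> C = One} \<union> {C \<in> circles D v. \<xi> C = X}"
    using UNIV_gen by auto
  moreover have "card ({C \<in> circles D v. \<xi> C = One} \<union> {C \<in> circles D v. \<xi> C = X})
      = card {C \<in> circles D v. \<xi> C = One} + card {C \<in> circles D v. \<xi> C = X}"
    using finite_circles[OF assms(1), of v] by (intro card_Un_disjoint) auto
  ultimately show ?thesis by (simp add: s q_degree_def x_circles_def)
qed

lemma hom_degree_fst: "fst s = fst t \<Longrightarrow> hom_degree D s = hom_degree D t"
  by (auto simp: hom_degree_def split: prod.splits)

lemma char_value_add: "char_value D (f + g) v S = char_value D f v S + char_value D g v S"
  unfolding char_value_def sum.distrib[symmetric] by (rule sum.cong) auto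

lemma Union_circles_inside:
  assumes "U \<subseteq> circles D v" "V \<subseteq> circles D v" "U \<subseteq> Pow (\<Union>V)"
  shows "U \<subseteq> V"
proof
  fix C assume C: "C \<in> U"
  then obtain a where a: "a \<in> C" using circles_nonempty assms(1) by blast
  then obtain C' where "C' \<in> V" "a \<in> C'" using C assms(3) by blast
  with a C circles_disjoint[of C D v C' a] assms show "C \<in> V" by auto
qed

text \<open>
  The characters separate chains. Among the states on which the two chains differ choose one, \<open>s\<close>, with the
  fewest circles labelled \<open>x\<close>, and let \<open>S\<close> be the union of these circles. A state with value \<open>1\<close>
  at \<open>S\<close> has its circles labelled \<open>x\<close> among those of \<open>s\<close>, so \<open>s\<close> alone contributes to the value of the
  difference.
\<close>

lemma char_value_eqI:
  assumes fin: "finite (arcs D)" and f: "supported D f" and g: "supported D g"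
    and eq: "\<And>v S. v \<subseteq> {..<n_crossings D} \<Longrightarrow> saturated D v S \<Longrightarrow> char_value D f v S = char_value D g v S"
  shows "f = g"
proof (rule ccontr)
  assume "f \<noteq> g"
  \<comment> \<open>In characteristic two the sum is the difference.\<close>
  define h where "h = f + g"
  then obtain s where "h s \<noteq> 0" using \<open>f \<noteq> g\<close>
    by (metis add.commute bit_add_self chain_add_self add_left_cancel fun_eq_iff plus_fun_apply)
  then obtain s where s: "h s \<noteq> 0" and min: "\<And>t. h t \<noteq> 0 \<Longrightarrow> card (x_circles D s) \<le> card (x_circles D t)"
    using ex_has_least_nat[of "\<lambda>s. h s \<noteq> 0" s "\<lambda>s. card (x_circles D s)"] by blast
  have h: "t \<in> states D" if "h t \<noteq> 0" for t
    using that f g unfolding h_def supported_def by (metis add.right_neutral plus_fun_apply)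
  define v S where "v = fst s" and "S = \<Union>(x_circles D s)"
  have v: "v \<subseteq> {..<n_crossings D}" using h[OF s] by (auto simp: v_def states_def)
  have sat: "saturated D v S" unfolding saturated_def
  proof
    fix C assume C: "C \<in> circles D v"
    have "C = C'" if "C' \<in> x_circles D s" "a \<in> C" "a \<in> C'" for C' a
      using circles_disjoint[OF C _ that(2,3)] that(1) x_circles_subset v_def by blast
    then show "C \<subseteq> S \<or> C \<subseteq> - S" unfolding S_def by blast
  qed
  have "char_value D h v S = (\<Sum>t\<in>{t \<in> states D. fst t = v}. if t = s then h s else 0)"
    unfolding char_value_def
  proof (rule sum.cong)
    fix t assume t: "t \<in> {t \<in> states D. fst t = v}"
    have "t = s" if "x_circles D t \<subseteq> Pow S" "h t \<noteq> 0"
    proof -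
      have sub: "x_circles D t \<subseteq> x_circles D s"
      proof (rule Union_circles_inside)
        show "x_circles D t \<subseteq> circles D v" "x_circles D s \<subseteq> circles D v"
          using x_circles_subset[of D t] x_circles_subset[of D s] t by (simp_all add: v_def)
        show "x_circles D t \<subseteq> Pow (\<Union>(x_circles D s))" using that(1) by (simp add: S_def)
      qed
      have "finite (x_circles D s)"
        by (rule finite_subset[OF x_circles_subset finite_circles[OF fin]])
      then have "x_circles D t = x_circles D s" using sub min[OF that(2)] by (metis card_seteq)
      then show "t = s" using t h[OF s] by (intro state_eqI[of t D s]) (auto simp: v_def)
    qed
    then show "(if x_circles D t \<subseteq> Pow S then h t else 0) = (if t = s then h s else 0)"
      unfolding S_def by auto
  qed simp
  also have "\<dots> = h s" using h[OF s] finite_states[OF fin] by (simp add: v_def)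
  finally have "char_value D h v S \<noteq> 0" using s by simp
  then show False using eq[OF v sat] by (simp add: h_def char_value_add bit_add_self)
qed

lemma char_value_linear_extension:
  assumes "finite (arcs D)"
  shows "char_value D (linear_extension D g f) v S = (\<Sum>s\<in>states D. f s * char_value D (g s) v S)"
proof -
  have "char_value D (linear_extension D g f) v S
    = (\<Sum>t\<in>{t \<in> states D. fst t = v}. \<Sum>s\<in>states D. f s * (if x_circles D t \<subseteq> Pow S then g s t else 0))"
    unfolding char_value_def by (rule sum.cong) (auto simp: linear_extension_apply)
  also have "\<dots> = (\<Sum>s\<in>states D. f s * char_value D (g s) v S)"
    unfolding char_value_def sum_distrib_left by (rule sum.swap)
  finally show ?thesis .
qed

lemma char_value_generator:
  assumes "finite (arcs D)" "s \<in> states D"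
  shows "char_value D (generator s) v S = (if fst s = v \<and> x_circles D s \<subseteq> Pow S then 1 else 0)"
proof -
  have "char_value D (generator s) v S
      = (\<Sum>t\<in>{t \<in> states D. fst t = v}. if t = s then (if x_circles D s \<subseteq> Pow S then 1 else 0) else 0)"
    unfolding char_value_def generator_def by (rule sum.cong) auto
  then show ?thesis using finite_states[OF assms(1)] assms(2) by simp
qed

section \<open>The basepoint action and the exchange of the idempotents\<close>

definition basepoint_x :: "diagram \<Rightarrow> nat \<Rightarrow> state \<Rightarrow> state" where
  "basepoint_x D p s = (fst s, (snd s)(circle D (fst s) p := X))"

lemma x_action_eq: "x_action D p = linear_extension D (\<lambda>s. generator (basepoint_x D p s))"
proof -
  have "mult X a = X" for a by (cases a) auto
  then show ?thesis unfolding x_action_def basepoint_x_def by (simp add: case_prod_unfold)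
qed

lemma basepoint_x_state:
  assumes "p \<in> arcs D" "s \<in> states D"
  shows "basepoint_x D p s \<in> states D"
    and "fst (basepoint_x D p s) = fst s"
    and "x_circles D (basepoint_x D p s) = insert (circle D (fst s) p) (x_circles D s)"
proof -
  have c: "circle D (fst s) p \<in> circles D (fst s)" using assms by (auto simp: circles_def)
  show "basepoint_x D p s \<in> states D"
    using c assms(2) by (auto simp: basepoint_x_def states_def PiE_def extensional_def)
  show "fst (basepoint_x D p s) = fst s"
    and "x_circles D (basepoint_x D p s) = insert (circle D (fst s) p) (x_circles D s)"
    using c by (auto simp: basepoint_x_def x_circles_def)
qed

lemma saturated_circle_iff:
  assumes "saturated D v S" "p \<in> arcs D"
  shows "circle D v p \<subseteq> S \<longleftrightarrow> p \<in> S"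
  using assms circle_self[of p D v] unfolding saturated_def circles_def by blast

lemma char_value_x_action:
  assumes fin: "finite (arcs D)" and p: "p \<in> arcs D" and sat: "saturated D v S"
  shows "char_value D (x_action D p f) v S = (if p \<in> S then char_value D f v S else 0)"
proof -
  have "char_value D (x_action D p f) v S
      = (\<Sum>s\<in>states D. if fst s = v then if p \<in> S \<and> x_circles D s \<subseteq> Pow S then f s else 0 else 0)"
    unfolding x_action_eq char_value_linear_extension[OF fin]
    using saturated_circle_iff[OF sat p]
    by (intro sum.cong) (auto simp: char_value_generator[OF fin] basepoint_x_state[OF p])
  also have "\<dots> = (if p \<in> S then char_value D f v S else 0)"
    unfolding char_value_def sum.inter_filter[OF finite_states[OF fin]] by (cases "p \<in> S") (simp_all cong: if_cong)
  finally show ?thesis .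
qed

text \<open>
  Since \<open>x\<close> goes to \<open>1 + x\<close> and \<open>1\<close> to \<open>1\<close>, a generator \<open>s\<close> is mapped to the sum of all generators \<open>t\<close>
  that arise from it by relabelling some of its circles from \<open>x\<close> to \<open>1\<close>.
\<close>

definition idempotent_swap :: "diagram \<Rightarrow> bit chain \<Rightarrow> bit chain" where
  "idempotent_swap D f t = (if t \<in> states D
     then \<Sum>s\<in>{s \<in> states D. fst s = fst t}. if x_circles D t \<subseteq> x_circles D s then f s else 0 else 0)"

lemma supported_idempotent_swap: "supported D (idempotent_swap D f)"
  by (auto simp: supported_def idempotent_swap_def)

lemma idempotent_swap_add:
  "idempotent_swap D (f + g) = idempotent_swap D f + idempotent_swap D g"
proof
  fix t
  have "(if P then (f + g) s else 0) = (if P then f s else 0) + (if P then g s else 0)" for P s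
    by simp
  then show "idempotent_swap D (f + g) t = (idempotent_swap D f + idempotent_swap D g) t"
    by (simp add: idempotent_swap_def sum.distrib)
qed

lemma idempotent_swap_zero: "idempotent_swap D 0 = 0"
  by (rule ext) (simp add: idempotent_swap_def cong: if_cong)

text \<open>
  The characters of \<open>A\<close> take the values \<open>0\<close> and \<open>1\<close> on \<open>x\<close>, and the exchange with \<open>1 + x\<close> swaps these values.
  In terms of generators: the coefficient of \<open>f s\<close> on the left counts the subsets of the set of those
  circles labelled \<open>x\<close> in \<open>s\<close> that lie in \<open>S\<close>. This number is a power of two, hence odd only if the
  set is empty, that is, if all circles labelled \<open>x\<close> lie in the complement of \<open>S\<close>.
\<close>

lemma char_value_idempotent_swap:
  assumes fin: "finite (arcs D)" and v: "v \<subseteq> {..<n_crossings D}" and sat: "saturated D v S"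
  shows "char_value D (idempotent_swap D f) v S = char_value D f v (- S)"
proof -
  let ?T = "{s \<in> states D. fst s = v}"
  have count: "(\<Sum>t\<in>?T. if x_circles D t \<subseteq> Pow S \<and> x_circles D t \<subseteq> x_circles D s then f s else 0)
      = (if x_circles D s \<subseteq> Pow (- S) then f s else 0)" if s: "s \<in> ?T" for s
  proof -
    define W where "W = x_circles D s \<inter> Pow S"
    have W: "W \<subseteq> circles D v" "finite W"
      using s x_circles_subset[of D s] finite_subset[OF _ finite_circles[OF fin, of v]] by (auto simp: W_def)
    have "(\<Sum>t\<in>?T. if x_circles D t \<subseteq> Pow S \<and> x_circles D t \<subseteq> x_circles D s then f s else 0)
        = (\<Sum>t\<in>?T. if x_circles D t \<in> Pow W then f s else 0)"
      by (rule sum.cong) (auto simp: W_def)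
    also have "\<dots> = (\<Sum>U\<in>Pow (circles D v). if U \<in> Pow W then f s else 0)"
      by (rule sum.reindex_bij_betw[OF bij_betw_x_circles[OF v]])
    also have "\<dots> = (\<Sum>U\<in>Pow W. f s)"
      using W finite_circles[OF fin] by (intro sum.mono_neutral_cong_right) auto
    also have "\<dots> = of_nat (2 ^ card W) * f s" using W by (simp add: card_Pow)
    also have "\<dots> = (if W = {} then f s else 0)" using W by (auto simp: card_gt_0_iff)
    also have "W = {} \<longleftrightarrow> x_circles D s \<subseteq> Pow (- S)"
    proof
      assume "W = {}"
      then show "x_circles D s \<subseteq> Pow (- S)"
        using sat s x_circles_subset[of D s] unfolding W_def saturated_def by blast
    next
      assume "x_circles D s \<subseteq> Pow (- S)"
      then have "C = {}" if "C \<in> W" for C using that unfolding W_def by blast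
      then show "W = {}" using circles_nonempty W(1) by blast
    qed
    finally show ?thesis .
  qed
  have "char_value D (idempotent_swap D f) v S
      = (\<Sum>t\<in>?T. \<Sum>s\<in>?T. if x_circles D t \<subseteq> Pow S \<and> x_circles D t \<subseteq> x_circles D s then f s else 0)"
    unfolding char_value_def idempotent_swap_def by (intro sum.cong refl) auto
  also have "\<dots> = (\<Sum>s\<in>?T. \<Sum>t\<in>?T. if x_circles D t \<subseteq> Pow S \<and> x_circles D t \<subseteq> x_circles D s then f s else 0)"
    by (rule sum.swap)
  also have "\<dots> = char_value D f v (- S)"
    unfolding char_value_def by (intro sum.cong refl count)
  finally show ?thesis .
qed

lemma supported_x_action:
  assumes "p \<in> arcs D"
  shows "supported D (x_action D p f)"
  unfolding supported_def x_action_eq linear_extension_apply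
proof (intro allI impI)
  fix t assume "(\<Sum>s\<in>states D. f s * generator (basepoint_x D p s) t) \<noteq> 0"
  then obtain s where "s \<in> states D" "generator (basepoint_x D p s) t \<noteq> (0::bit)"
    by (metis (no_types, lifting) mult_zero_right sum.neutral)
  then show "t \<in> states D" using basepoint_x_state(1)[OF assms] by (auto simp: generator_def split: if_splits)
qed

lemma idempotent_swap_involution:
  assumes fin: "finite (arcs D)" and f: "supported D f"
  shows "idempotent_swap D (idempotent_swap D f) = f"
  by (rule char_value_eqI[OF fin supported_idempotent_swap f])
    (simp add: char_value_idempotent_swap[OF fin] saturated_compl)

lemma x_action_idem:
  assumes fin: "finite (arcs D)" and p: "p \<in> arcs D"
  shows "x_action D p (x_action D p f) = (x_action D p f :: bit chain)"
  by (rule char_value_eqI[OF fin supported_x_action[OF p] supported_x_action[OF p]])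
    (simp add: char_value_x_action[OF fin p])

lemma idempotent_swap_x_action:
  assumes fin: "finite (arcs D)" and p: "p \<in> arcs D" and f: "supported D f"
  shows "idempotent_swap D (x_action D p (idempotent_swap D f)) = f + x_action D p f"
proof (rule char_value_eqI[OF fin supported_idempotent_swap])
  show "supported D (f + x_action D p f)"
    using f supported_x_action[OF p, of f] unfolding supported_def by (metis add.right_neutral plus_fun_apply)
qed (auto simp: char_value_idempotent_swap[OF fin] char_value_x_action[OF fin p] saturated_compl
      char_value_add bit_add_self)


section \<open>The differential on character values\<close>

text \<open>
  The edges of the cube that merge two circles or split one; all others act by \<open>0\<close>.
\<close>

definition genuine_edge :: "diagram \<Rightarrow> nat \<Rightarrow> nat set \<Rightarrow> nat set \<Rightarrow> bool" where
  "genuine_edge D c v w \<longleftrightarrow>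
    (circle D v (lower_in D c) = circle D v (lower_out D c)) \<noteq>
    (circle D w (lower_in D c) = circle D w (lower_out D c))"

text \<open>
  Merging is the multiplication, which the characters respect, and a colouring constant on the merged
  circle is constant on the two circles it came from. For a split, \<open>\<Delta>(x) = x \<otimes> x\<close> and
  \<open>\<Delta>(1 + x) = (1 + x) \<otimes> (1 + x)\<close>: a pair of different characters annihilates \<open>\<Delta>(A)\<close>,
  and a pair of equal ones restricts to the character itself.
\<close>

lemma char_value_edge:
  assumes fin: "finite (arcs D)" and c: "c < n_crossings D" "c \<notin> fst s" and s: "s \<in> states D"
    and w: "w = insert c (fst s)" and sat: "saturated D w S"
  shows "(\<Sum>t\<in>{t \<in> states D. fst t = w}. if x_circles D t \<subseteq> Pow S then edge_coeff D c s t else (0::bit))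
    = (if genuine_edge D c (fst s) w \<and> saturated D (fst s) S \<and> x_circles D s \<subseteq> Pow S then 1 else 0)"
proof -
  obtain v \<xi> where s_eq: "s = (v, \<xi>)" by (cases s)
  define A B A' B' R where "A = circle D v (lower_in D c)" and "B = circle D v (lower_out D c)"
    and "A' = circle D w (lower_in D c)" and "B' = circle D w (lower_out D c)"
    and "R = circles D v - {A, B}"
  have vw: "v - {c} = w - {c}" using w by (auto simp: s_eq)
  have R: "R = circles D w - {A', B'}"
    using other_circles_eq[OF c(1) vw] by (simp add: R_def A_def B_def A'_def B'_def)
  have Un: "A \<union> B = A' \<union> B'"
    using crossing_circles_Un[OF c(1) vw] by (simp add: A_def B_def A'_def B'_def)
  have cv: "circles D v = insert A (insert B R)"
    using crossing_circles_in[OF c(1), of v] by (auto simp: R_def A_def B_def)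
  have cw: "circles D w = insert A' (insert B' R)"
    using crossing_circles_in[OF c(1), of w] by (auto simp: R A'_def B'_def)
  have notR: "A \<notin> R" "B \<notin> R" "A' \<notin> R" "B' \<notin> R"
    using R by (auto simp: R_def)
  have ne: "A \<noteq> {}" "B \<noteq> {}" "A' \<noteq> {}" "B' \<noteq> {}"
    using circle_self unfolding A_def B_def A'_def B'_def by (metis empty_iff)+
  have satR: "\<forall>C\<in>R. C \<subseteq> S \<or> C \<subseteq> - S" and sat': "A' \<subseteq> S \<or> A' \<subseteq> - S" "B' \<subseteq> S \<or> B' \<subseteq> - S"
    using sat by (auto simp: saturated_def cw)
  have wn: "w \<subseteq> {..<n_crossings D}" using s c(1) w by (auto simp: states_def)
  define Rx where "Rx = {C \<in> R. \<xi> C = X}"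
  have xs: "x_circles D s = Rx \<union> (if \<xi> A = X then {A} else {}) \<union> (if \<xi> B = X then {B} else {})"
    by (auto simp: x_circles_def s_eq cv Rx_def)
  \<comment> \<open>The states of \<open>w\<close> that agree with \<open>s\<close> off the crossing: only these have nonzero coefficients.\<close>
  define st where "st a b = (w, \<lambda>C\<in>circles D w. if C = A' then a else if C = B' then b else \<xi> C)" for a b
  have st: "st a b \<in> states D" "fst (st a b) = w" for a b
    using wn by (auto simp: st_def states_def)
  have st_snd: "snd (st a b) A' = a" "A' \<noteq> B' \<Longrightarrow> snd (st a b) B' = b" for a b
    by (auto simp: st_def cw)
  have st_R: "C \<in> R \<Longrightarrow> snd (st a b) C = \<xi> C" for a b C
    using notR by (auto simp: st_def cw)
  have st_xs: "x_circles D (st a b) =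
      Rx \<union> (if a = X then {A'} else {}) \<union> (if A' \<noteq> B' \<and> b = X then {B'} else {})" for a b
    using notR by (auto simp: x_circles_def st_def cw Rx_def)
  have is_st: "t = st (snd t A') (snd t B')"
    if "t \<in> states D" "fst t = w" "\<forall>C\<in>R. snd t C = \<xi> C" for t
  proof (rule prod_eqI)
    show "snd t = snd (st (snd t A') (snd t B'))"
    proof
      fix C
      have "snd t C = undefined" if "C \<notin> circles D w"
        using \<open>t \<in> states D\<close> \<open>fst t = w\<close> that by (auto simp: states_def PiE_def extensional_def)
      moreover have "snd t C = \<xi> C" if "C \<in> circles D w" "C \<noteq> A'" "C \<noteq> B'"
        using that \<open>\<forall>C\<in>R. snd t C = \<xi> C\<close> cw by blast
      ultimately show "snd t C = snd (st (snd t A') (snd t B')) C"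
        by (simp add: st_def restrict_def)
    qed
  qed (use that st in simp)
  have coeff: "edge_coeff D c s t =
      (if \<exists>C\<in>R. snd t C \<noteq> \<xi> C then 0
       else if A \<noteq> B \<and> A' = B' then (if snd t A' = mult (\<xi> A) (\<xi> B) then 1 else 0)
       else if A = B \<and> A' \<noteq> B' then comult (\<xi> A) (snd t A') (snd t B') else (0::bit))"
    if "fst t = w" for t
    using that by (cases t) (simp add: s_eq edge_coeff_def Let_def A_def B_def A'_def B'_def R_def)
  let ?T = "{t \<in> states D. fst t = w}"
  let ?L = "\<Sum>t\<in>?T. if x_circles D t \<subseteq> Pow S then edge_coeff D c s t else (0::bit)"
  have finT: "finite ?T" using finite_states[OF fin] by simp
  consider (merge) "A \<noteq> B" "A' = B'" | (split) "A = B" "A' \<noteq> B'" | (none) "(A = B) = (A' = B')" by blast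
  then show ?thesis
  proof cases
    case merge
    define m where "m = mult (\<xi> A) (\<xi> B)"
    have e: "edge_coeff D c s t = (if t = st m m then 1 else (0::bit))" if "t \<in> ?T" for t
      using that merge is_st[of t] coeff[of t] st_R[of _ m m] st_snd(1)[of m m] by (auto simp: m_def)
    have "?L = (\<Sum>t\<in>?T. if t = st m m then if x_circles D (st m m) \<subseteq> Pow S then 1 else 0 else 0)"
      by (intro sum.cong refl) (simp add: e st)
    also have "\<dots> = (if x_circles D (st m m) \<subseteq> Pow S then 1 else 0)" using st finT by simp
    finally have L: "?L = (if x_circles D (st m m) \<subseteq> Pow S then 1 else 0)" .
    have "saturated D v S" using satR sat' Un merge by (auto simp: saturated_def cv)
    moreover have "m = X \<longleftrightarrow> \<xi> A = X \<or> \<xi> B = X" unfolding m_def by (cases "\<xi> A"; cases "\<xi> B") auto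
    moreover have "A \<subseteq> S \<longleftrightarrow> A' \<subseteq> S" "B \<subseteq> S \<longleftrightarrow> A' \<subseteq> S" using sat' Un merge ne by blast+
    ultimately have "(saturated D v S \<and> x_circles D s \<subseteq> Pow S) = (x_circles D (st m m) \<subseteq> Pow S)"
      by (auto simp: xs st_xs merge(2))
    moreover have "genuine_edge D c v w" using merge by (simp add: genuine_edge_def A_def B_def A'_def B'_def)
    ultimately show ?thesis by (simp add: L s_eq)
  next
    case split
    have inj: "inj_on (\<lambda>(a, b). st a b) UNIV"
      using st_snd split by (auto intro!: inj_onI) metis+
    have "?L = (\<Sum>t\<in>(\<lambda>(a, b). st a b) ` UNIV. if x_circles D t \<subseteq> Pow S then edge_coeff D c s t else 0)"
    proof (rule sum.mono_neutral_right[OF finT])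
      show "(\<lambda>(a, b). st a b) ` UNIV \<subseteq> ?T" using st by auto
      have "t \<in> (\<lambda>(a, b). st a b) ` UNIV" if "t \<in> ?T" "\<forall>C\<in>R. snd t C = \<xi> C" for t
        using is_st[of t] that by (metis (mono_tags, lifting) case_prod_conv mem_Collect_eq rangeI)
      then have "edge_coeff D c s t = (0::bit)" if "t \<in> ?T - (\<lambda>(a, b). st a b) ` UNIV" for t
        using that coeff[of t] by (metis (mono_tags, lifting) DiffE mem_Collect_eq)
      then show "\<forall>t\<in>?T - (\<lambda>(a, b). st a b) ` UNIV. (if x_circles D t \<subseteq> Pow S then edge_coeff D c s t else 0) = (0::bit)"
        by auto
    qed
    also have "\<dots> = (\<Sum>(a, b)\<in>UNIV. if x_circles D (st a b) \<subseteq> Pow S then comult (\<xi> A) a b else 0)"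
    proof -
      have "edge_coeff D c s (st a b) = (comult (\<xi> A) a b :: bit)" for a b
        using split st_R st_snd by (simp add: coeff[OF st(2)])
      then show ?thesis unfolding sum.reindex[OF inj] by (intro sum.cong refl) (simp add: case_prod_beta)
    qed
    also have "\<dots> = (\<Sum>a\<in>{One, X}. \<Sum>b\<in>{One, X}. if x_circles D (st a b) \<subseteq> Pow S then comult (\<xi> A) a b else 0)"
      by (simp only: UNIV_Times_UNIV[symmetric] UNIV_gen sum.cartesian_product)
    finally have L: "?L = (if x_circles D (st One One) \<subseteq> Pow S then comult (\<xi> A) One One else 0)
      + (if x_circles D (st One X) \<subseteq> Pow S then comult (\<xi> A) One X else 0)
      + ((if x_circles D (st X One) \<subseteq> Pow S then comult (\<xi> A) X One else 0)
      + (if x_circles D (st X X) \<subseteq> Pow S then comult (\<xi> A) X X else 0))" by simp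
    have A: "A = A' \<union> B'" using Un split by simp
    have satv: "saturated D v S \<longleftrightarrow> (A' \<subseteq> S \<longleftrightarrow> B' \<subseteq> S)"
      using satR sat' ne split unfolding saturated_def cv A by auto
    have fs: "fst s = v" by (simp add: s_eq)
    have gen: "genuine_edge D c v w" using split by (simp add: genuine_edge_def A_def B_def A'_def B'_def)
    have "A \<subseteq> S \<longleftrightarrow> A' \<subseteq> S \<and> B' \<subseteq> S" using A by auto
    then show ?thesis
      unfolding L using split satv gen
      by (cases "\<xi> A"; cases "A' \<subseteq> S"; cases "B' \<subseteq> S"; cases "Rx \<subseteq> Pow S")
        (simp_all add: xs st_xs fs bit_add_self)
  next
    case none
    then have "?L = 0" by (intro sum.neutral) (auto simp: coeff)
    moreover have "\<not> genuine_edge D c v w" using none by (simp add: genuine_edge_def A_def B_def A'_def B'_def)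
    ultimately show ?thesis by (simp add: s_eq)
  qed
qed

text \<open>
  The coefficients depend on \<open>S\<close> only through saturation, which is the same for \<open>S\<close> and its complement.
  This is why the differential commutes with the exchange of the idempotents.
\<close>

lemma char_value_differential:
  assumes fin: "finite (arcs D)" and w: "w \<subseteq> {..<n_crossings D}" and sat: "saturated D w S"
  shows "char_value D (bn_differential D f) w S =
    (\<Sum>c\<in>w. if genuine_edge D c (w - {c}) w \<and> saturated D (w - {c}) S
             then char_value D f (w - {c}) S else 0)"
proof -
  let ?T = "{t \<in> states D. fst t = w}"
  let ?K = "\<lambda>c. genuine_edge D c (w - {c}) w \<and> saturated D (w - {c}) S"
  define g :: "state \<Rightarrow> bit chain" where "g s t = (\<Sum>c\<in>{..<n_crossings D} - fst s.
       if t \<in> states D \<and> fst t = insert c (fst s) then edge_coeff D c s t else 0)" for s t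
  have d: "bn_differential D = linear_extension D g"
    unfolding bn_differential_def g_def by (simp add: cong: if_cong)
  have g: "char_value D (g s) w S =
      (\<Sum>c\<in>w. if ?K c \<and> fst s = w - {c} \<and> x_circles D s \<subseteq> Pow S then 1 else 0)"
    if s: "s \<in> states D" for s
  proof -
    have "char_value D (g s) w S = (\<Sum>t\<in>?T. \<Sum>c\<in>{..<n_crossings D} - fst s.
        if w = insert c (fst s) then (if x_circles D t \<subseteq> Pow S then edge_coeff D c s t else 0) else 0)"
      unfolding char_value_def
    proof (intro sum.cong refl)
      fix t assume t: "t \<in> ?T"
      show "(if x_circles D t \<subseteq> Pow S then g s t else 0) = (\<Sum>c\<in>{..<n_crossings D} - fst s.
        if w = insert c (fst s) then (if x_circles D t \<subseteq> Pow S then edge_coeff D c s t else 0) else 0)"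
        using t by (cases "x_circles D t \<subseteq> Pow S") (simp_all add: g_def cong: if_cong)
    qed
    also have "\<dots> = (\<Sum>c\<in>{..<n_crossings D} - fst s. \<Sum>t\<in>?T.
        if w = insert c (fst s) then (if x_circles D t \<subseteq> Pow S then edge_coeff D c s t else 0) else 0)"
      by (rule sum.swap)
    also have "\<dots> = (\<Sum>c\<in>{..<n_crossings D} - fst s. if w = insert c (fst s)
        then (if genuine_edge D c (fst s) w \<and> saturated D (fst s) S \<and> x_circles D s \<subseteq> Pow S then 1 else 0) else 0)"
    proof (intro sum.cong refl)
      fix c assume c: "c \<in> {..<n_crossings D} - fst s"
      show "(\<Sum>t\<in>?T. if w = insert c (fst s) then (if x_circles D t \<subseteq> Pow S then edge_coeff D c s t else (0::bit)) else 0)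
        = (if w = insert c (fst s) then (if genuine_edge D c (fst s) w \<and> saturated D (fst s) S \<and> x_circles D s \<subseteq> Pow S then 1 else 0) else 0)"
      proof (cases "w = insert c (fst s)")
        case True
        then show ?thesis using char_value_edge[OF fin _ _ s True sat] c by simp
      qed simp
    qed
    also have "\<dots> = (\<Sum>c\<in>w. if ?K c \<and> fst s = w - {c} \<and> x_circles D s \<subseteq> Pow S then 1 else 0)"
    proof (rule sum.mono_neutral_cong)
      show "finite w" using w finite_subset by blast
    qed (use w in auto)
    finally show ?thesis .
  qed
  have "char_value D (bn_differential D f) w S
      = (\<Sum>s\<in>states D. \<Sum>c\<in>w. f s * (if ?K c \<and> fst s = w - {c} \<and> x_circles D s \<subseteq> Pow S then 1 else 0))"
    unfolding d char_value_linear_extension[OF fin] sum_distrib_left[symmetric]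
    by (intro sum.cong refl) (simp add: g)
  also have "\<dots> = (\<Sum>c\<in>w. \<Sum>s\<in>states D. f s * (if ?K c \<and> fst s = w - {c} \<and> x_circles D s \<subseteq> Pow S then 1 else 0))"
    by (rule sum.swap)
  also have "\<dots> = (\<Sum>c\<in>w. if ?K c then char_value D f (w - {c}) S else 0)"
  proof (intro sum.cong refl)
    fix c
    show "(\<Sum>s\<in>states D. f s * (if ?K c \<and> fst s = w - {c} \<and> x_circles D s \<subseteq> Pow S then 1 else 0))
        = (if ?K c then char_value D f (w - {c}) S else 0)"
      unfolding char_value_def sum.inter_filter[OF finite_states[OF fin]]
      by (cases "?K c") (auto intro!: sum.cong sum.neutral)
  qed
  finally show ?thesis .
qed

lemma bn_differential_nonzero:
  fixes f :: "'r::comm_ring_1 chain"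
  assumes "bn_differential D f t \<noteq> 0"
  obtains s c where "f s \<noteq> 0" "s \<in> states D" "c \<notin> fst s" "t \<in> states D" "fst t = insert c (fst s)"
proof -
  let ?g = "\<lambda>s c. if t \<in> states D \<and> fst t = insert c (fst s)
      then (- 1) ^ card {j \<in> fst s. j < c} * edge_coeff D c s t else (0::'r)"
  have "(\<Sum>s\<in>states D. f s * (\<Sum>c\<in>{..<n_crossings D} - fst s. ?g s c)) \<noteq> 0"
    using assms by (simp only: bn_differential_def linear_extension_apply not_False_eq_True)
  from sum.not_neutral_contains_not_neutral[OF this]
  obtain s where s: "s \<in> states D" "f s * (\<Sum>c\<in>{..<n_crossings D} - fst s. ?g s c) \<noteq> 0" .
  then have "f s \<noteq> 0" "(\<Sum>c\<in>{..<n_crossings D} - fst s. ?g s c) \<noteq> 0" by auto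
  from this(1) sum.not_neutral_contains_not_neutral[OF this(2)]
  obtain c where "c \<in> {..<n_crossings D} - fst s" "?g s c \<noteq> 0" "f s \<noteq> 0" by metis
  with s(1) show ?thesis by (intro that[of s c]) (auto split: if_splits)
qed

lemma supported_differential: "supported D (bn_differential D f)"
  using bn_differential_nonzero unfolding supported_def by metis

lemma differential_idempotent_swap:
  assumes fin: "finite (arcs D)"
  shows "bn_differential D (idempotent_swap D f) = idempotent_swap D (bn_differential D f)"
proof (rule char_value_eqI[OF fin supported_differential supported_idempotent_swap])
  fix w S assume w: "w \<subseteq> {..<n_crossings D}" and sat: "saturated D w S"
  have "char_value D (bn_differential D (idempotent_swap D f)) w S = char_value D (bn_differential D f) w (- S)"
    using w by (auto simp: char_value_differential[OF fin w] sat saturated_compl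
        intro!: sum.cong char_value_idempotent_swap[OF fin])
  then show "char_value D (bn_differential D (idempotent_swap D f)) w S
      = char_value D (idempotent_swap D (bn_differential D f)) w S"
    by (simp add: char_value_idempotent_swap[OF fin w sat])
qed

lemma differential_x_action:
  assumes fin: "finite (arcs D)" and p: "p \<in> arcs D"
  shows "bn_differential D (x_action D p f) = (x_action D p (bn_differential D f) :: bit chain)"
proof (rule char_value_eqI[OF fin supported_differential supported_x_action[OF p]])
  fix w S assume w: "w \<subseteq> {..<n_crossings D}" and sat: "saturated D w S"
  show "char_value D (bn_differential D (x_action D p f)) w S
      = char_value D (x_action D p (bn_differential D f)) w S"
    by (auto simp: char_value_x_action[OF fin p sat] char_value_differential[OF fin w sat]
        char_value_x_action[OF fin p] intro!: sum.cong sum.neutral)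
qed


section \<open>The filtered isomorphism\<close>

lemma cochains_supported:
  assumes "finite (arcs D)" "f \<in> cochains (bn_complex D :: (bit, bit chain) filtered_complex) n"
  shows "supported D f"
  using assms by (auto simp: cochains_bn supported_def)

lemma filtration_subset_cochains:
  assumes "finite (arcs D)"
  shows "filtration (bn_complex D :: (bit, bit chain) filtered_complex) q n \<subseteq> cochains (bn_complex D) n"
  using assms by (auto simp: cochains_bn filtration_bn)

lemma cochains_bn_add:
  assumes "finite (arcs D)"
    and "f \<in> cochains (bn_complex D :: (bit, bit chain) filtered_complex) n" "g \<in> cochains (bn_complex D) n"
  shows "f + g \<in> cochains (bn_complex D) n"
  using assms(2,3) unfolding cochains_bn[OF assms(1)] by simp (metis add.right_neutral)

lemma filtration_bn_add:
  assumes "finite (arcs D)"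
    and "f \<in> filtration (bn_complex D :: (bit, bit chain) filtered_complex) q n" "g \<in> filtration (bn_complex D) q n"
  shows "f + g \<in> filtration (bn_complex D) q n"
  using assms(2,3) unfolding filtration_bn[OF assms(1)] by simp (metis add.right_neutral)

lemma filtration_bn_antimono:
  assumes "finite (arcs D)" "q \<le> q'"
  shows "filtration (bn_complex D :: (bit, bit chain) filtered_complex) q' n \<subseteq> filtration (bn_complex D) q n"
  using assms(2) unfolding filtration_bn[OF assms(1)] by fastforce

lemma x_action_nonzero:
  assumes "p \<in> arcs D" "x_action D p f t \<noteq> (0::bit)"
  obtains s where "s \<in> states D" "f s \<noteq> 0" "t = basepoint_x D p s"
proof -
  obtain s where "s \<in> states D" "f s * generator (basepoint_x D p s) t \<noteq> 0"
    using assms(2) sum.not_neutral_contains_not_neutral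
    unfolding x_action_eq linear_extension_apply by blast
  then show ?thesis by (intro that[of s]) (auto simp: generator_def split: if_splits)
qed

lemma x_action_cochains:
  assumes fin: "finite (arcs D)" and p: "p \<in> arcs D"
    and f: "f \<in> cochains (bn_complex D :: (bit, bit chain) filtered_complex) n"
  shows "x_action D p f \<in> cochains (bn_complex D) n"
  unfolding cochains_bn[OF fin]
proof (intro CollectI allI impI)
  fix t assume "x_action D p f t \<noteq> 0"
  then obtain s where "s \<in> states D" "f s \<noteq> 0" "t = basepoint_x D p s"
    by (rule x_action_nonzero[OF p])
  then show "t \<in> states D \<and> hom_degree D t = n"
    using f basepoint_x_state(1,2)[OF p, of s] hom_degree_fst[of t s]
    unfolding cochains_bn[OF fin] by auto
qed

text \<open>
  The action relabels at most one circle from \<open>1\<close> to \<open>x\<close>, which lowers the \<open>q\<close>-degree by two.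
\<close>

lemma x_action_filtration:
  assumes fin: "finite (arcs D)" and p: "p \<in> arcs D"
    and f: "f \<in> filtration (bn_complex D :: (bit, bit chain) filtered_complex) q n"
  shows "x_action D p f \<in> filtration (bn_complex D) (q - 2) n"
  unfolding filtration_bn[OF fin]
proof (intro CollectI allI impI)
  fix t assume "x_action D p f t \<noteq> 0"
  then obtain s where s: "s \<in> states D" "f s \<noteq> 0" "t = basepoint_x D p s"
    by (rule x_action_nonzero[OF p])
  note t = basepoint_x_state[OF p s(1), folded s(3)]
  have fs: "hom_degree D s = n" "q \<le> q_degree D s" using f s(2) unfolding filtration_bn[OF fin] by auto
  have "card (x_circles D t) \<le> Suc (card (x_circles D s))"
    using finite_subset[OF x_circles_subset finite_circles[OF fin]] by (simp add: t(3) card_insert_if)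
  then have "q - 2 \<le> q_degree D t"
    using fs(2) t(1,2) s(1) by (simp add: q_degree_eq[OF fin])
  then show "t \<in> states D \<and> hom_degree D t = n \<and> q - 2 \<le> q_degree D t"
    using t hom_degree_fst[OF t(2)] fs(1) by simp
qed

lemma idempotent_swap_nonzero:
  assumes "idempotent_swap D f t \<noteq> 0"
  obtains s where "s \<in> states D" "t \<in> states D" "fst s = fst t" "f s \<noteq> 0"
proof -
  have t: "t \<in> states D" using assms by (auto simp: idempotent_swap_def split: if_splits)
  then have "(\<Sum>s\<in>{s \<in> states D. fst s = fst t}. if x_circles D t \<subseteq> x_circles D s then f s else 0) \<noteq> 0"
    using assms by (simp add: idempotent_swap_def)
  from sum.not_neutral_contains_not_neutral[OF this]
  obtain s where "s \<in> {s \<in> states D. fst s = fst t}"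
    "(if x_circles D t \<subseteq> x_circles D s then f s else 0) \<noteq> 0" .
  then show ?thesis using t by (intro that[of s]) (auto split: if_splits)
qed

lemma idempotent_swap_cochains:
  assumes fin: "finite (arcs D)"
    and f: "f \<in> cochains (bn_complex D :: (bit, bit chain) filtered_complex) n"
  shows "idempotent_swap D f \<in> cochains (bn_complex D) n"
  unfolding cochains_bn[OF fin]
proof (intro CollectI allI impI)
  fix t assume "idempotent_swap D f t \<noteq> 0"
  then obtain s where "t \<in> states D" "fst s = fst t" "f s \<noteq> 0" by (rule idempotent_swap_nonzero)
  then show "t \<in> states D \<and> hom_degree D t = n"
    using f hom_degree_fst[of s t] unfolding cochains_bn[OF fin] by auto
qed

text \<open>
  The summand of \<open>I s\<close> with no circle relabelled is \<open>s\<close> and cancels; every other summand has fewer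
  circles labelled \<open>x\<close>, and each relabelling raises the \<open>q\<close>-degree by two.
\<close>

lemma idempotent_swap_raises_filtration:
  assumes fin: "finite (arcs D)"
    and f: "f \<in> filtration (bn_complex D :: (bit, bit chain) filtered_complex) q n"
  shows "f + idempotent_swap D f \<in> filtration (bn_complex D) (q + 2) n"
  unfolding filtration_bn[OF fin]
proof (intro CollectI allI impI)
  fix t assume nz: "(f + idempotent_swap D f) t \<noteq> 0"
  have f': "f s \<noteq> 0 \<Longrightarrow> s \<in> states D \<and> hom_degree D s = n \<and> q \<le> q_degree D s" for s
    using f unfolding filtration_bn[OF fin] by auto
  have t: "t \<in> states D" using nz f' by (auto simp: idempotent_swap_def split: if_splits)
  let ?T = "{s \<in> states D. fst s = fst t}"
  let ?g = "\<lambda>s. if x_circles D t \<subseteq> x_circles D s then f s else 0"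
  have "idempotent_swap D f t = f t + (\<Sum>s\<in>?T - {t}. ?g s)"
    using sum.remove[of ?T t ?g] finite_states[OF fin] t by (simp add: idempotent_swap_def)
  then have "(f + idempotent_swap D f) t = (\<Sum>s\<in>?T - {t}. ?g s)"
    by (simp add: add.assoc[symmetric] bit_add_self)
  then obtain s where s: "s \<in> ?T - {t}" "?g s \<noteq> 0"
    using nz sum.not_neutral_contains_not_neutral[of ?g "?T - {t}"] by auto
  then have "x_circles D t \<subset> x_circles D s" using t state_eqI[of s D t] by (auto split: if_splits)
  then have "card (x_circles D t) < card (x_circles D s)"
    by (rule psubset_card_mono[rotated]) (rule finite_subset[OF x_circles_subset finite_circles[OF fin]])
  moreover have "hom_degree D s = n" "q \<le> q_degree D s" using s f' by (auto split: if_splits)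
  ultimately show "t \<in> states D \<and> hom_degree D t = n \<and> q + 2 \<le> q_degree D t"
    using t s hom_degree_fst[of s t] by (simp add: q_degree_eq[OF fin])
qed

lemma idempotent_swap_filtration:
  assumes fin: "finite (arcs D)"
    and f: "f \<in> filtration (bn_complex D :: (bit, bit chain) filtered_complex) q n"
  shows "idempotent_swap D f \<in> filtration (bn_complex D) q n"
proof -
  have "f + idempotent_swap D f \<in> filtration (bn_complex D) q n"
    using idempotent_swap_raises_filtration[OF fin f] filtration_bn_antimono[OF fin, of q "q + 2"] by auto
  from filtration_bn_add[OF fin f this] show ?thesis
    by (simp add: add.assoc[symmetric] chain_add_self)
qed

lemma bn_differential_cochains:
  assumes fin: "finite (arcs D)"
    and f: "f \<in> cochains (bn_complex D :: (bit, bit chain) filtered_complex) n"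
  shows "bn_differential D f \<in> cochains (bn_complex D) (n + 1)"
  unfolding cochains_bn[OF fin]
proof (intro CollectI allI impI)
  fix t assume "bn_differential D f t \<noteq> 0"
  then obtain s c where s: "f s \<noteq> 0" "s \<in> states D" "c \<notin> fst s" "t \<in> states D" "fst t = insert c (fst s)"
    by (rule bn_differential_nonzero)
  have "finite (fst s)" using s(2) finite_subset[OF _ finite_lessThan] by (auto simp: states_def)
  then have "hom_degree D t = hom_degree D s + 1"
    using s(3,5) by (simp add: hom_degree_def case_prod_beta)
  then show "t \<in> states D \<and> hom_degree D t = n + 1"
    using f s(1,4) unfolding cochains_bn[OF fin] by simp
qed

definition splitting :: "diagram \<Rightarrow> nat \<Rightarrow> bit chain \<Rightarrow> bit chain \<times> bit chain" where
  "splitting D p f = (x_action D p (f + idempotent_swap D f), x_action D p f)"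

definition unsplitting :: "diagram \<Rightarrow> bit chain \<times> bit chain \<Rightarrow> bit chain" where
  "unsplitting D = (\<lambda>(g, h). (h + idempotent_swap D h) + idempotent_swap D g)"

lemma x_action_add: "x_action D p (f + g) = x_action D p f + (x_action D p g :: bit chain)"
  by (simp add: x_action_def linear_extension_add)

lemma unsplitting_splitting:
  assumes fin: "finite (arcs D)" and p: "p \<in> arcs D" and f: "supported D f"
  shows "unsplitting D (splitting D p f) = f"
proof -
  let ?x = "x_action D p" and ?I = "idempotent_swap D"
  have "unsplitting D (splitting D p f) = ?x f + (?I (?x f) + ?I (?x f)) + ?I (?x (?I f))"
    by (simp add: unsplitting_def splitting_def x_action_add idempotent_swap_add add_ac)
  also have "\<dots> = ?x f + ?x f + f"
    by (simp add: chain_add_self idempotent_swap_x_action[OF fin p f] add_ac)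
  finally show ?thesis by (simp add: chain_add_self)
qed

text \<open>
  On chains with \<open>x u = u\<close> the relation \<open>I x I = id + x\<close> gives \<open>x (I u) = 0\<close>.
\<close>

lemma splitting_unsplitting:
  assumes fin: "finite (arcs D)" and p: "p \<in> arcs D"
    and g: "x_action D p g = g" and h: "x_action D p h = h"
  shows "splitting D p (unsplitting D (g, h)) = (g, h)"
proof -
  let ?x = "x_action D p" and ?I = "idempotent_swap D"
  have supp: "supported D g" "supported D h" using supported_x_action[OF p] g h by metis+
  have xI: "?x (?I u) = 0" if u: "?x u = u" for u :: "bit chain"
  proof -
    have "supported D u" using supported_x_action[OF p, of u] u by simp
    then have "?I (?x (?I u)) = 0"
      by (simp add: idempotent_swap_x_action[OF fin p] u chain_add_self)
    then have "?I (?I (?x (?I u))) = ?I 0" by simp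
    then show ?thesis
      using idempotent_swap_zero idempotent_swap_involution[OF fin supported_x_action[OF p]] by simp
  qed
  let ?f = "unsplitting D (g, h)"
  have "?x ?f = h"
    by (simp add: unsplitting_def x_action_add g h xI)
  moreover have "?I ?f = ?I h + h + g"
    by (simp add: unsplitting_def idempotent_swap_add idempotent_swap_involution[OF fin] supp)
  then have "?x (?I ?f) = h + g" by (simp add: x_action_add g h xI)
  ultimately show ?thesis
    by (simp add: splitting_def x_action_add add.assoc[symmetric] chain_add_self)
qed

text \<open>
  The common pattern for cochain groups, with \<open>V = U\<close>, and filtration pieces, with \<open>U = F\<^sub>q\<close> and
  \<open>V = F\<^bsub>q+2\<^esub>\<close>.
\<close>

lemma splitting_image:
  assumes fin: "finite (arcs D)" and p: "p \<in> arcs D" and supp: "\<And>f. f \<in> U \<Longrightarrow> supported D f"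
    and 1: "\<And>f. f \<in> U \<Longrightarrow> f + idempotent_swap D f \<in> V"
    and 2: "\<And>g h. g \<in> V \<Longrightarrow> h \<in> U \<Longrightarrow> unsplitting D (x_action D p g, x_action D p h) \<in> U"
  shows "splitting D p ` U = x_action D p ` V \<times> x_action D p ` U"
proof
  show "splitting D p ` U \<subseteq> x_action D p ` V \<times> x_action D p ` U"
    using 1 by (auto simp: splitting_def)
  show "x_action D p ` V \<times> x_action D p ` U \<subseteq> splitting D p ` U"
  proof clarify
    fix g h assume gh: "g \<in> V" "h \<in> U"
    have "splitting D p (unsplitting D (x_action D p g, x_action D p h)) = (x_action D p g, x_action D p h)"
      by (rule splitting_unsplitting[OF fin p]) (simp_all add: x_action_idem[OF fin p])
    then show "(x_action D p g, x_action D p h) \<in> splitting D p ` U"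
      using 2[OF gh] by (metis imageI)
  qed
qed

lemma chain_scale_bit: "chain_scale c (f :: bit chain) = (if c = 0 then 0 else f)"
  by (cases c) (auto simp: chain_scale_def)

theorem filtered_iso_splitting:
  assumes fin: "finite (arcs D)" and p: "p \<in> arcs D"
  shows "filtered_iso Q (bn_complex D :: (bit, bit chain) filtered_complex)
    (direct_sum (shift_filtration 1 (reduced_bn_complex D p)) (shift_filtration (- 1) (reduced_bn_complex D p)))
    (\<lambda>_. splitting D p)"
  unfolding filtered_iso_def
proof (intro allI conjI ballI)
  fix n q
  let ?K = "bn_complex D :: (bit, bit chain) filtered_complex"
  let ?R = "reduced_bn_complex D p :: (bit, bit chain) filtered_complex"
  let ?L = "direct_sum (shift_filtration 1 ?R) (shift_filtration (- 1) ?R)"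
  let ?I = "idempotent_swap D"
  note supp = cochains_supported[OF fin]
  have "inj_on (splitting D p) (cochains ?K n)"
    using unsplitting_splitting[OF fin p] supp by (metis inj_onI)
  moreover have "splitting D p ` cochains ?K n
      = x_action D p ` cochains ?K n \<times> x_action D p ` cochains ?K n"
    by (rule splitting_image[OF fin p])
      (auto simp: unsplitting_def intro!: supp cochains_bn_add[OF fin] idempotent_swap_cochains[OF fin] x_action_cochains[OF fin p])
  ultimately show "bij_betw (splitting D p) (cochains ?K n) (cochains ?L n)"
    by (simp add: bij_betw_def direct_sum_def shift_filtration_def reduced_bn_complex_def)
  have "splitting D p ` filtration ?K q n
      = x_action D p ` filtration ?K (q + 2) n \<times> x_action D p ` filtration ?K q n"
  proof (rule splitting_image[OF fin p])
    fix g h assume g: "g \<in> filtration ?K (q + 2) n" and h: "h \<in> filtration ?K q n"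
    have "x_action D p h + ?I (x_action D p h) \<in> filtration ?K q n"
      using idempotent_swap_raises_filtration[OF fin x_action_filtration[OF fin p h]] by simp
    moreover have "?I (x_action D p g) \<in> filtration ?K q n"
      using idempotent_swap_filtration[OF fin x_action_filtration[OF fin p g]] by simp
    ultimately show "unsplitting D (x_action D p g, x_action D p h) \<in> filtration ?K q n"
      by (simp add: unsplitting_def filtration_bn_add[OF fin])
  qed (use supp filtration_subset_cochains[OF fin] idempotent_swap_raises_filtration[OF fin] in blast)+
  then show "splitting D p ` filtration ?K q n = filtration ?L q n"
    by (simp add: direct_sum_def shift_filtration_def reduced_bn_complex_def add.commute)
  fix f assume f: "f \<in> cochains ?K n"
  show "splitting D p (differential ?K f) = differential ?L (splitting D p f)"
    by (simp add: splitting_def direct_sum_def shift_filtration_def reduced_bn_complex_def bn_complex_def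
        x_action_add bn_differential_def linear_extension_add
        differential_x_action[OF fin p, unfolded bn_differential_def]
        differential_idempotent_swap[OF fin, unfolded bn_differential_def])
  show "splitting D p (scalar ?K c f) = scalar ?L c (splitting D p f)" for c
    by (simp add: splitting_def direct_sum_def shift_filtration_def reduced_bn_complex_def bn_complex_def
        chain_scale_bit x_action_def linear_extension_zero idempotent_swap_zero)
  fix g
  show "splitting D p (f + g) = splitting D p f + splitting D p g"
    by (simp add: splitting_def x_action_add idempotent_swap_add plus_prod_def add_ac)
qed


section \<open>Isomorphisms of spectral sequences\<close>

lemma spectral_iso_trans:
  assumes "spectral_iso Q E F \<psi>" "spectral_iso Q F G \<psi>'" "\<And>q r. q \<in> Q \<Longrightarrow> q + 2 * int r \<in> Q"
  shows "spectral_iso Q E G (\<lambda>r q n. \<psi>' r q n \<circ> \<psi> r q n)"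
  unfolding spectral_iso_def
proof (intro allI ballI conjI)
  fix r q n assume q: "q \<in> Q"
  note 1 = assms(1)[unfolded spectral_iso_def, rule_format, OF q, of r n]
  note 2 = assms(2)[unfolded spectral_iso_def, rule_format, OF q, of r n]
  have im: "\<psi> r q n x \<in> page F r q n" if "x \<in> page E r q n" for x
    using 1 that by (auto dest: bij_betwE)
  show "bij_betw (\<psi>' r q n \<circ> \<psi> r q n) (page E r q n) (page G r q n)"
    by (rule bij_betw_trans[OF conjunct1[OF 1] conjunct1[OF 2]])
  show "map_prod (\<psi>' r q n \<circ> \<psi> r q n) (\<psi>' (Suc r) q n \<circ> \<psi> (Suc r) q n) ` survives E r q n = survives G r q n"
    unfolding map_prod_compose image_comp[symmetric] using 1 2 by simp
  fix x assume x: "x \<in> page E r q n"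
  show "(\<psi>' r q n \<circ> \<psi> r q n) (page_scalar E r q n c x) = page_scalar G r q n c ((\<psi>' r q n \<circ> \<psi> r q n) x)" for c
    using 1 2 im[OF x] x by simp
  show "(\<psi>' r (q + 2 * int r) (n + 1) \<circ> \<psi> r (q + 2 * int r) (n + 1)) (page_diff E r q n x)
      = page_diff G r q n ((\<psi>' r q n \<circ> \<psi> r q n) x)"
    using 1 2 im[OF x] x by simp
  fix y assume y: "y \<in> page E r q n"
  show "(\<psi>' r q n \<circ> \<psi> r q n) (page_add E r q n x y)
      = page_add G r q n ((\<psi>' r q n \<circ> \<psi> r q n) x) ((\<psi>' r q n \<circ> \<psi> r q n) y)"
    using 1 2 im[OF x] im[OF y] x y by simp
qed

lemma image_set_plus:
  assumes "\<And>a b. a \<in> U \<Longrightarrow> b \<in> U \<Longrightarrow> f (a + b) = f a + f b" "A \<subseteq> U" "B \<subseteq> U"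
  shows "f ` (A + B) = f ` A + f ` B"
proof
  show "f ` (A + B) \<subseteq> f ` A + f ` B"
    using assms by (auto elim!: set_plus_elim) (metis image_eqI set_plus_intro subsetD)
  show "f ` A + f ` B \<subseteq> f ` (A + B)"
    using assms by (auto elim!: set_plus_elim) (metis image_eqI set_plus_intro subsetD)
qed

lemma elt_set_plus_eq: "z +o B = {z} + B"
  by (auto simp: elt_set_plus_def set_plus_def)

text \<open>
  Approximate cycles are defined by membership of a chain and of its differential in filtration pieces.
  An isomorphism preserves and, being injective on cochains, reflects these conditions; all further
  constructions are images and sums of sets of cochains.
\<close>

lemma spectral_iso_of_filtered_iso:
  fixes K :: "('r, 'a::ab_group_add) filtered_complex" and L :: "('r, 'b::ab_group_add) filtered_complex"
  assumes iso: "filtered_iso Q K L \<phi>"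
    and Q: "\<And>q k. q \<in> Q \<Longrightarrow> q + 2 * k \<in> Q"
    and sub: "\<And>q n. filtration K q n \<subseteq> cochains K n"
    and add: "\<And>n a b. a \<in> cochains K n \<Longrightarrow> b \<in> cochains K n \<Longrightarrow> a + b \<in> cochains K n"
    and scale: "\<And>n c a. a \<in> cochains K n \<Longrightarrow> scalar K c a \<in> cochains K n"
    and diff: "\<And>n a. a \<in> cochains K n \<Longrightarrow> differential K a \<in> cochains K (n + 1)"
  shows "spectral_iso Q (spectral_sequence K) (spectral_sequence L) (\<lambda>r q n. (`) (\<phi> n))"
proof -
  note iso' = iso[unfolded filtered_iso_def, rule_format]
  have inj: "inj_on (\<phi> n) (cochains K n)" for n
    using iso' by (auto simp: bij_betw_def)
  have hom: "\<phi> n (a + b) = \<phi> n a + \<phi> n b" if "a \<in> cochains K n" "b \<in> cochains K n" for n a b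
    using iso' that by blast
  have lin: "\<phi> n (scalar K c a) = scalar L c (\<phi> n a)" if "a \<in> cochains K n" for n c a
    using iso' that by blast
  have dif: "\<phi> (n + 1) (differential K a) = differential L (\<phi> n a)" if "a \<in> cochains K n" for n a
    using iso' that by blast
  have filt: "\<phi> n ` filtration K q n = filtration L q n" if "q \<in> Q" for q n
    using iso' that by blast
  have plus: "A + B \<subseteq> cochains K n" if "A \<subseteq> cochains K n" "B \<subseteq> cochains K n" for A B n
    using that by (blast elim: set_plus_elim intro: add)
  have im_plus: "\<phi> n ` (A + B) = \<phi> n ` A + \<phi> n ` B" if "A \<subseteq> cochains K n" "B \<subseteq> cochains K n" for A B n
    by (rule image_set_plus[OF hom that])
  have im_dif: "\<phi> (n + 1) ` differential K ` A = differential L ` \<phi> n ` A" if "A \<subseteq> cochains K n" for A n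
    unfolding image_image using that dif by (intro image_cong) auto
  have Z_sub: "approx_cycles K r q n \<subseteq> cochains K n" for r q n
    using sub by (auto simp: approx_cycles_def)
  have Z: "\<phi> n ` approx_cycles K r q n = approx_cycles L r q n" if q: "q \<in> Q" for r q n
  proof
    show "\<phi> n ` approx_cycles K r q n \<subseteq> approx_cycles L r q n"
      using filt[OF q, of n] filt[OF Q[OF q, of r], of "n + 1"] dif sub
      unfolding approx_cycles_def by (force simp: image_iff)
    show "approx_cycles L r q n \<subseteq> \<phi> n ` approx_cycles K r q n"
    proof
      fix b assume b: "b \<in> approx_cycles L r q n"
      then obtain a where a: "a \<in> filtration K q n" "b = \<phi> n a"
        using filt[OF q, of n] by (auto simp: approx_cycles_def)
      have aC: "a \<in> cochains K n" using a(1) sub by blast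
      have "\<phi> (n + 1) (differential K a) \<in> \<phi> (n + 1) ` filtration K (q + 2 * r) (n + 1)"
        using b filt[OF Q[OF q, of r], of "n + 1"] dif[OF aC] a(2) by (simp add: approx_cycles_def)
      then have "differential K a \<in> filtration K (q + 2 * r) (n + 1)"
        using inj_on_image_mem_iff[OF inj diff[OF aC] sub] by blast
      then show "b \<in> \<phi> n ` approx_cycles K r q n" using a by (auto simp: approx_cycles_def)
    qed
  qed
  have dZ_sub: "differential K ` approx_cycles K r q (n - 1) \<subseteq> cochains K n" for r q n
    using diff[of _ "n - 1"] Z_sub[of r q "n - 1"] by auto
  have B_sub: "approx_bounds K r q n \<subseteq> cochains K n" for r q n
    unfolding approx_bounds_def by (intro plus Z_sub dZ_sub)
  have B: "\<phi> n ` approx_bounds K r q n = approx_bounds L r q n" if q: "q \<in> Q" for r q n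
  proof -
    have "q + 2 \<in> Q" "q - 2 * (r - 1) \<in> Q" using Q[OF q, of 1] Q[OF q, of "1 - r"] by (simp_all add: algebra_simps)
    then show ?thesis
      using im_dif[OF Z_sub, of "n - 1"]
      by (simp add: approx_bounds_def im_plus[OF Z_sub dZ_sub] Z)
  qed
  have coset: "\<phi> n ` (z +o approx_bounds K r q n) = \<phi> n z +o approx_bounds L r q n"
    if "q \<in> Q" "z \<in> cochains K n" for z r q n
    unfolding elt_set_plus_eq using that by (subst im_plus) (simp_all add: B_sub B)
  have coset_Z: "\<phi> n ` (z +o approx_bounds K r q n) = \<phi> n z +o approx_bounds L r q n"
    if "q \<in> Q" "z \<in> approx_cycles K r' q' n" for z r r' q q' n
    using coset that Z_sub by blast
  have coset_sub: "z +o approx_bounds K r q n \<subseteq> cochains K n" if "z \<in> cochains K n" for z r q n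
    unfolding elt_set_plus_eq using that by (intro plus B_sub) auto
  have page_sub: "x \<subseteq> cochains K n" if "x \<in> page (spectral_sequence K) r q n" for x r q n
    using that Z_sub coset_sub unfolding spectral_sequence_def by fastforce
  show ?thesis
    unfolding spectral_iso_def
  proof (intro allI ballI conjI)
    fix r q n assume q: "q \<in> Q"
    have "inj_on ((`) (\<phi> n)) (page (spectral_sequence K) r q n)"
      by (rule inj_onI) (metis inj inj_on_image_eq_iff page_sub)
    moreover have "(`) (\<phi> n) ` page (spectral_sequence K) r q n = page (spectral_sequence L) r q n"
    proof -
      have "(`) (\<phi> n) ` page (spectral_sequence K) r q n
          = (\<lambda>z. \<phi> n z +o approx_bounds L (int r) q n) ` approx_cycles K (int r) q n"
        by (simp add: spectral_sequence_def image_image coset_Z[OF q] cong: image_cong_simp)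
      also have "\<dots> = page (spectral_sequence L) r q n"
        by (simp add: spectral_sequence_def Z[OF q, symmetric] image_image)
      finally show ?thesis .
    qed
    ultimately show "bij_betw ((`) (\<phi> n)) (page (spectral_sequence K) r q n) (page (spectral_sequence L) r q n)"
      by (simp add: bij_betw_def)
    have "map_prod ((`) (\<phi> n)) ((`) (\<phi> n)) ` survives (spectral_sequence K) r q n
        = (\<lambda>z. (\<phi> n z +o approx_bounds L (int r) q n, \<phi> n z +o approx_bounds L (int r + 1) q n))
            ` approx_cycles K (int r + 1) q n"
      by (simp add: spectral_sequence_def image_image coset_Z[OF q] cong: image_cong_simp)
    also have "\<dots> = survives (spectral_sequence L) r q n"
      by (simp add: spectral_sequence_def Z[OF q, symmetric] image_image)
    finally show "map_prod ((`) (\<phi> n)) ((`) (\<phi> n)) ` survives (spectral_sequence K) r q n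
        = survives (spectral_sequence L) r q n" .
    fix x assume x: "x \<in> page (spectral_sequence K) r q n"
    show "\<phi> n ` page_scalar (spectral_sequence K) r q n c x
        = page_scalar (spectral_sequence L) r q n c (\<phi> n ` x)" for c
    proof -
      have "scalar K c ` x \<subseteq> cochains K n" using page_sub[OF x] scale by auto
      moreover have "\<phi> n ` scalar K c ` x = scalar L c ` \<phi> n ` x"
        unfolding image_image using page_sub[OF x] lin by (intro image_cong) auto
      ultimately show ?thesis by (simp add: spectral_sequence_def im_plus B_sub B[OF q])
    qed
    show "\<phi> (n + 1) ` page_diff (spectral_sequence K) r q n x
        = page_diff (spectral_sequence L) r q n (\<phi> n ` x)"
    proof -
      have "differential K ` x \<subseteq> cochains K (n + 1)" using page_sub[OF x] diff by auto
      then show ?thesis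
        by (simp add: spectral_sequence_def im_plus B_sub B[OF Q[OF q]] im_dif[OF page_sub[OF x]])
    qed
    fix y assume "y \<in> page (spectral_sequence K) r q n"
    then show "\<phi> n ` page_add (spectral_sequence K) r q n x y
        = page_add (spectral_sequence L) r q n (\<phi> n ` x) (\<phi> n ` y)"
      by (simp add: spectral_sequence_def im_plus[OF page_sub page_sub, OF x])
  qed
qed

lemma set_plus_Times: "(A \<times> B) + (C \<times> E) = (A + C) \<times> (B + E)"
  by (fastforce simp: set_plus_def)

text \<open>
  Coset by coset, the pages of the sum consist of products of nonempty sets, which are determined by
  their two projections. The conditions on \<open>0\<close> make the approximate boundaries, and so the cosets,
  nonempty.
\<close>

lemma spectral_iso_direct_sum:
  fixes K :: "('r, 'a::ab_group_add) filtered_complex" and L :: "('r, 'b::ab_group_add) filtered_complex"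
  assumes "\<And>q n. 0 \<in> filtration K q n" "\<And>q n. 0 \<in> filtration L q n"
    and "differential K 0 = 0" "differential L 0 = 0"
  shows "spectral_iso Q (spectral_sequence (direct_sum K L))
    (spectral_sum (spectral_sequence K) (spectral_sequence L)) (\<lambda>r q n x. (fst ` x, snd ` x))"
proof -
  let ?\<pi> = "\<lambda>x::('a \<times> 'b) set. (fst ` x, snd ` x)"
  have Z: "approx_cycles (direct_sum K L) r q n = approx_cycles K r q n \<times> approx_cycles L r q n" for r q n
    by (auto simp: approx_cycles_def direct_sum_def)
  have map_prod_Times: "map_prod f g ` (A \<times> B) = f ` A \<times> g ` B" for f g A B
    by auto
  have B: "approx_bounds (direct_sum K L) r q n = approx_bounds K r q n \<times> approx_bounds L r q n" for r q n
    by (simp add: approx_bounds_def Z set_plus_Times)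
      (simp add: direct_sum_def map_prod_Times set_plus_Times)
  have pl: "A + B \<noteq> {}" if "A \<noteq> {}" "B \<noteq> {}" for A B :: "'c::plus set"
    using that by (auto simp: set_plus_def)
  have ne: "approx_bounds K r q n \<noteq> {}" "approx_bounds L r q n \<noteq> {}" for r q n
  proof -
    have "0 \<in> approx_cycles K r q n" "0 \<in> approx_cycles L r q n" for r q n
      using assms by (simp_all add: approx_cycles_def)
    then show "approx_bounds K r q n \<noteq> {}" "approx_bounds L r q n \<noteq> {}"
      unfolding approx_bounds_def by (metis emptyE image_is_empty pl)+
  qed
  have ne': "z +o approx_bounds K r q n \<noteq> {}" "z' +o approx_bounds L r q n \<noteq> {}" for z z' r q n
    by (simp_all add: elt_set_plus_eq pl ne)
  have coset: "z +o approx_bounds (direct_sum K L) r q n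
      = (fst z +o approx_bounds K r q n) \<times> (snd z +o approx_bounds L r q n)" for z r q n
    unfolding elt_set_plus_eq B set_plus_Times[symmetric] by (cases z) simp
  have pair: "?\<pi> (x \<times> y) = (x, y)" if "x \<noteq> {}" "y \<noteq> {}" for x y
    using that by auto
  have image_Times: "(\<lambda>z. (f (fst z), g (snd z))) ` (A \<times> B) = f ` A \<times> g ` B"
    for f :: "'a \<Rightarrow> 'a set" and g :: "'b \<Rightarrow> 'b set" and A B by force
  have image_pairs_Times: "(\<lambda>z. ((f (fst z), g (snd z)), (f' (fst z), g' (snd z)))) ` (A \<times> B)
      = {(x, y). (fst x, fst y) \<in> (\<lambda>z. (f z, f' z)) ` A \<and> (snd x, snd y) \<in> (\<lambda>z. (g z, g' z)) ` B}"
    for f f' :: "'a \<Rightarrow> 'a set" and g g' :: "'b \<Rightarrow> 'b set" and A B by force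
  have page: "x \<in> page (spectral_sequence (direct_sum K L)) r q n \<Longrightarrow>
      \<exists>y z. x = y \<times> z \<and> y \<noteq> {} \<and> z \<noteq> {}" for x r q n
    using ne' by (fastforce simp: spectral_sequence_def Z coset)
  show ?thesis
    unfolding spectral_iso_def
  proof (intro allI ballI conjI)
    fix r q n
    have "inj_on ?\<pi> (page (spectral_sequence (direct_sum K L)) r q n)"
    proof (rule inj_onI)
      fix x y
      assume xy: "x \<in> page (spectral_sequence (direct_sum K L)) r q n"
        "y \<in> page (spectral_sequence (direct_sum K L)) r q n" and eq: "?\<pi> x = ?\<pi> y"
      have "x = fst (?\<pi> x) \<times> snd (?\<pi> x)" "y = fst (?\<pi> y) \<times> snd (?\<pi> y)"
        using page[OF xy(1)] page[OF xy(2)] by auto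
      then show "x = y" using eq by simp
    qed
    moreover have "?\<pi> ` page (spectral_sequence (direct_sum K L)) r q n
        = page (spectral_sum (spectral_sequence K) (spectral_sequence L)) r q n"
      using image_Times[of "\<lambda>z. z +o approx_bounds K (int r) q n" "\<lambda>z. z +o approx_bounds L (int r) q n"]
      by (simp add: spectral_sequence_def spectral_sum_def Z image_image coset ne')
    ultimately show "bij_betw ?\<pi> (page (spectral_sequence (direct_sum K L)) r q n)
        (page (spectral_sum (spectral_sequence K) (spectral_sequence L)) r q n)"
      by (simp add: bij_betw_def)
    show "map_prod ?\<pi> ?\<pi> ` survives (spectral_sequence (direct_sum K L)) r q n
        = survives (spectral_sum (spectral_sequence K) (spectral_sequence L)) r q n"
      using image_pairs_Times[of
          "\<lambda>z. z +o approx_bounds K (int r) q n" "\<lambda>z. z +o approx_bounds L (int r) q n"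
          "\<lambda>z. z +o approx_bounds K (int r + 1) q n" "\<lambda>z. z +o approx_bounds L (int r + 1) q n"
          "approx_cycles K (int r + 1) q n" "approx_cycles L (int r + 1) q n"]
      by (simp add: spectral_sequence_def spectral_sum_def Z image_image coset ne')
    fix x assume "x \<in> page (spectral_sequence (direct_sum K L)) r q n"
    then obtain x1 x2 where x: "x = x1 \<times> x2" "x1 \<noteq> {}" "x2 \<noteq> {}" using page by blast
    have sc: "scalar (direct_sum K L) c ` (x1 \<times> x2) = (scalar K c ` x1) \<times> (scalar L c ` x2)" for c
      by (simp add: direct_sum_def map_prod_Times)
    show "?\<pi> (page_scalar (spectral_sequence (direct_sum K L)) r q n c x)
        = page_scalar (spectral_sum (spectral_sequence K) (spectral_sequence L)) r q n c (?\<pi> x)" for c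
      using x(2,3) by (simp add: spectral_sequence_def spectral_sum_def sc B set_plus_Times x(1) pl ne)
    have df: "differential (direct_sum K L) ` (x1 \<times> x2) = (differential K ` x1) \<times> (differential L ` x2)"
      by (simp add: direct_sum_def map_prod_Times)
    show "?\<pi> (page_diff (spectral_sequence (direct_sum K L)) r q n x)
        = page_diff (spectral_sum (spectral_sequence K) (spectral_sequence L)) r q n (?\<pi> x)"
      using x(2,3) by (simp add: spectral_sequence_def spectral_sum_def df B set_plus_Times x(1) pl ne)
    fix y assume "y \<in> page (spectral_sequence (direct_sum K L)) r q n"
    then obtain y1 y2 where y: "y = y1 \<times> y2" "y1 \<noteq> {}" "y2 \<noteq> {}" using page by blast
    show "?\<pi> (page_add (spectral_sequence (direct_sum K L)) r q n x y)
        = page_add (spectral_sum (spectral_sequence K) (spectral_sequence L)) r q n (?\<pi> x) (?\<pi> y)"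
      using x(2,3) y(2,3) by (simp add: spectral_sequence_def spectral_sum_def set_plus_Times x(1) y(1) pl)
  qed
qed

section \<open>The splitting\<close>

lemma q_indices_shift: "q \<in> q_indices D \<Longrightarrow> q + 2 * k \<in> q_indices D"
  by (auto simp: q_indices_def)

theorem theorem3p2:
  fixes D :: diagram and p :: nat
  assumes "link_diagram D" and "p \<in> arcs D"
  shows
    "(\<exists>\<phi>. filtered_iso (q_indices D)
        (bn_complex D :: (bit, bit chain) filtered_complex)
        (direct_sum
          (shift_filtration 1 (reduced_bn_complex D p))
          (shift_filtration (- 1) (reduced_bn_complex D p)))
        \<phi>) \<and>
     (\<exists>\<psi>. spectral_iso (q_indices D)
        (spectral_sequence (bn_complex D :: (bit, bit chain) filtered_complex))
        (spectral_sum
          (spectral_sequence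
            (shift_filtration 1 (reduced_bn_complex D p :: (bit, bit chain) filtered_complex)))
          (spectral_sequence
            (shift_filtration (- 1) (reduced_bn_complex D p :: (bit, bit chain) filtered_complex))))
        \<psi>)"
proof -
  let ?K = "bn_complex D :: (bit, bit chain) filtered_complex"
  let ?R = "reduced_bn_complex D p :: (bit, bit chain) filtered_complex"
  note fin = link_diagram_finite_arcs[OF assms(1)]
  have iso: "filtered_iso (q_indices D) ?K
      (direct_sum (shift_filtration 1 ?R) (shift_filtration (- 1) ?R)) (\<lambda>_. splitting D p)"
    by (rule filtered_iso_splitting[OF fin assms(2)])
  have 1: "spectral_iso (q_indices D) (spectral_sequence ?K)
      (spectral_sequence (direct_sum (shift_filtration 1 ?R) (shift_filtration (- 1) ?R)))
      (\<lambda>r q n. (`) (splitting D p))"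
  proof (rule spectral_iso_of_filtered_iso[OF iso])
    fix n a c assume a: "a \<in> cochains ?K n"
    have "scalar ?K c a = (if c = 0 then 0 else a)" by (simp add: bn_complex_def chain_scale_bit)
    then show "scalar ?K c a \<in> cochains ?K n" using a by (simp add: cochains_bn[OF fin])
    show "differential ?K a \<in> cochains ?K (n + 1)"
      using bn_differential_cochains[OF fin a] by (simp add: bn_complex_def)
  qed (simp_all add: q_indices_shift filtration_subset_cochains[OF fin] cochains_bn_add[OF fin])
  have zero: "0 \<in> x_action D p ` filtration ?K q n" for q n
  proof (rule image_eqI)
    show "0 = x_action D p (0 :: bit chain)" by (simp add: x_action_def linear_extension_zero)
    show "0 \<in> filtration ?K q n" by (simp add: filtration_bn[OF fin])
  qed
  have 2: "spectral_iso (q_indices D)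
      (spectral_sequence (direct_sum (shift_filtration 1 ?R) (shift_filtration (- 1) ?R)))
      (spectral_sum (spectral_sequence (shift_filtration 1 ?R)) (spectral_sequence (shift_filtration (- 1) ?R)))
      (\<lambda>r q n x. (fst ` x, snd ` x))"
    by (rule spectral_iso_direct_sum)
      (simp_all add: shift_filtration_def reduced_bn_complex_def zero bn_differential_def linear_extension_zero)
  show ?thesis using iso spectral_iso_trans[OF 1 2 q_indices_shift] by blast
qed

end
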